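(* The planar pure braid group $\overline{P}_6$ is isomorphic to the free product of $71$ copies of the infinite cyclic group $\mathbb{Z}$ and $20$ copies of the free abelian group $F_2^{\mathrm{ab}}\cong\mathbb{Z}^2$ of rank two.
   Context: For $n\ge 1$, the group of planar braids $\overline{B}_n$ is the group with generators $\sigma_1,\ldots,\sigma_{n-1}$ and relations $\sigma_i^2=1$ for all $1\le i<n$, and $\sigma_i\sigma_j=\sigma_j\sigma_i$ for all $1\le i,j<n$ with $|i-j|>1$. There is a surjective homomorphism $\overline{B}_n\to S_n$ to the symmetric group sending $\sigma_i$ to the transposition $(i\ \, i+1)$ (equivalently, $S_n$ is obtained from $\overline{B}_n$ by adding the relations $(\sigma_i\sigma_{i+1})^3=1$ for $1\le i<n-1$). The planar pure braid group $\overline{P}_n$ is the kernel of this homomorphism. *)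

theory Defs
  imports "HOL-Algebra.Sym_Groups" "HOL-Algebra.Free_Abelian_Groups"
begin

section \<open>Presentations\<close>

text \<open>The least congruence on the free monoid \<^term>\<open>lists A\<close> that contains the pairs of
  words \<^term>\<open>R\<close>. Pairs in \<^term>\<open>R\<close> that mention letters outside \<^term>\<open>A\<close> are ignored.\<close>

inductive_set word_cong :: "'a set \<Rightarrow> ('a list \<times> 'a list) set \<Rightarrow> ('a list \<times> 'a list) set"
  for A :: "'a set" and R :: "('a list \<times> 'a list) set"
  where
    base: "(u, v) \<in> R \<Longrightarrow> u \<in> lists A \<Longrightarrow> v \<in> lists A \<Longrightarrow> (u, v) \<in> word_cong A R"
  | refl: "u \<in> lists A \<Longrightarrow> (u, u) \<in> word_cong A R"
  | sym: "(u, v) \<in> word_cong A R \<Longrightarrow> (v, u) \<in> word_cong A R"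
  | trans: "(u, v) \<in> word_cong A R \<Longrightarrow> (v, w) \<in> word_cong A R \<Longrightarrow> (u, w) \<in> word_cong A R"
  | append: "(u, v) \<in> word_cong A R \<Longrightarrow> (u', v') \<in> word_cong A R \<Longrightarrow>
      (u @ u', v @ v') \<in> word_cong A R"

definition presented_monoid :: "'a set \<Rightarrow> ('a list \<times> 'a list) set \<Rightarrow> 'a list set monoid"
  where "presented_monoid A R =
    \<lparr>carrier = lists A // word_cong A R,
     mult = (\<lambda>U V. \<Union>u\<in>U. \<Union>v\<in>V. word_cong A R `` {u @ v}),
     one = word_cong A R `` {[]}\<rparr>"

text \<open>In group presentations the letter \<^term>\<open>(x, True)\<close> stands for the generator
  \<^term>\<open>x\<close> and \<^term>\<open>(x, False)\<close> for its formal inverse; a pair \<^term>\<open>(u, v)\<close> of words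
  is the relation \<^term>\<open>u = v\<close>.\<close>

definition inverse_relations :: "'x set \<Rightarrow> (('x \<times> bool) list \<times> ('x \<times> bool) list) set"
  where "inverse_relations X = {([(x, b), (x, \<not> b)], []) | x b. x \<in> X}"

definition presented_group ::
    "'x set \<Rightarrow> (('x \<times> bool) list \<times> ('x \<times> bool) list) set \<Rightarrow> ('x \<times> bool) list set monoid"
  where "presented_group X R = presented_monoid (X \<times> UNIV) (inverse_relations X \<union> R)"

primrec word_value :: "('b, 'c) monoid_scheme \<Rightarrow> ('x \<Rightarrow> 'b) \<Rightarrow> ('x \<times> bool) list \<Rightarrow> 'b"
  where
    "word_value H f [] = \<one>\<^bsub>H\<^esub>"
  | "word_value H f (l # w) =
      (if snd l then f (fst l) else inv\<^bsub>H\<^esub> (f (fst l))) \<otimes>\<^bsub>H\<^esub> word_value H f w"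

text \<open>The map on a presented group induced by a map \<^term>\<open>f\<close> on generators. It is meaningful
  only if \<^term>\<open>f\<close> respects the relations, since then all words of a class have the same
  value.\<close>

definition induced_hom ::
    "('b, 'c) monoid_scheme \<Rightarrow> ('x \<Rightarrow> 'b) \<Rightarrow> ('x \<times> bool) list set \<Rightarrow> 'b"
  where "induced_hom H f U = (THE h. \<forall>w\<in>U. word_value H f w = h)"


section \<open>Free products\<close>

text \<open>Words in the disjoint union of the groups, modulo deleting identity letters and multiplying
  adjacent letters from the same factor.\<close>

definition free_product_relations ::
    "'i set \<Rightarrow> ('i \<Rightarrow> ('a, 'b) monoid_scheme) \<Rightarrow> (('i \<times> 'a) list \<times> ('i \<times> 'a) list) set"
  where "free_product_relations I G =
    {([(i, \<one>\<^bsub>G i\<^esub>)], []) | i. i \<in> I} \<union>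
    {([(i, x), (i, y)], [(i, x \<otimes>\<^bsub>G i\<^esub> y)]) | i x y.
       i \<in> I \<and> x \<in> carrier (G i) \<and> y \<in> carrier (G i)}"

definition free_product ::
    "'i set \<Rightarrow> ('i \<Rightarrow> ('a, 'b) monoid_scheme) \<Rightarrow> ('i \<times> 'a) list set monoid"
  where "free_product I G =
    presented_monoid (SIGMA i:I. carrier (G i)) (free_product_relations I G)"


section \<open>Planar braids\<close>

definition planar_braid_relations :: "nat \<Rightarrow> ((nat \<times> bool) list \<times> (nat \<times> bool) list) set"
  where "planar_braid_relations n =
    {([(i, True), (i, True)], []) | i. i \<in> {1..<n}} \<union>
    {([(i, True), (j, True)], [(j, True), (i, True)]) | i j.
       i \<in> {1..<n} \<and> j \<in> {1..<n} \<and> \<bar>int i - int j\<bar> > 1}"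

definition planar_braid_group :: "nat \<Rightarrow> (nat \<times> bool) list set monoid"
  where "planar_braid_group n = presented_group {1..<n} (planar_braid_relations n)"

definition planar_braid_perm :: "nat \<Rightarrow> (nat \<times> bool) list set \<Rightarrow> nat \<Rightarrow> nat"
  where "planar_braid_perm n = induced_hom (sym_group n) (\<lambda>i. transpose i (i + 1))"

definition planar_pure_braid_group :: "nat \<Rightarrow> (nat \<times> bool) list set monoid"
  where "planar_pure_braid_group n =
    (planar_braid_group n)
      \<lparr>carrier := kernel (planar_braid_group n) (sym_group n) (planar_braid_perm n)\<rparr>"


section \<open>Basic properties\<close>

lemma word_cong_lists:
  "(u, v) \<in> word_cong A R \<Longrightarrow> u \<in> lists A \<and> v \<in> lists A"
  by (induction rule: word_cong.induct) auto

lemma equiv_word_cong: "equiv (lists A) (word_cong A R)"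
proof (rule equivI)
  show "word_cong A R \<subseteq> lists A \<times> lists A"
    using word_cong_lists by fastforce
  show "refl_on (lists A) (word_cong A R)"
    by (auto simp: refl_on_def intro: word_cong.refl)
  show "Relation.sym (word_cong A R)"
    by (auto intro: symI word_cong.sym)
  show "Relation.trans (word_cong A R)"
    by (auto intro: transI word_cong.trans)
qed

lemma word_class_eq_iff:
  assumes "u \<in> lists A" "v \<in> lists A"
  shows "word_cong A R `` {u} = word_cong A R `` {v} \<longleftrightarrow> (u, v) \<in> word_cong A R"
  using eq_equiv_class_iff[OF equiv_word_cong assms] .

lemma presented_monoid_carrierE:
  assumes "U \<in> carrier (presented_monoid A R)"
  obtains u where "u \<in> lists A" "U = word_cong A R `` {u}"
  using assms unfolding presented_monoid_def by (auto elim!: quotientE)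

lemma presented_monoid_class_closed:
  "u \<in> lists A \<Longrightarrow> word_cong A R `` {u} \<in> carrier (presented_monoid A R)"
  by (simp add: presented_monoid_def quotientI)

lemma presented_monoid_one: "\<one>\<^bsub>presented_monoid A R\<^esub> = word_cong A R `` {[]}"
  by (simp add: presented_monoid_def)

lemma presented_monoid_mult:
  assumes "u \<in> lists A" "v \<in> lists A"
  shows "word_cong A R `` {u} \<otimes>\<^bsub>presented_monoid A R\<^esub> word_cong A R `` {v}
    = word_cong A R `` {u @ v}"
proof -
  have "word_cong A R `` {u' @ v'} = word_cong A R `` {u @ v}"
    if "u' \<in> word_cong A R `` {u}" "v' \<in> word_cong A R `` {v}" for u' v'
    using that by (intro equiv_class_eq[OF equiv_word_cong])
      (auto intro: word_cong.append word_cong.sym)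
  moreover have "u \<in> word_cong A R `` {u}" "v \<in> word_cong A R `` {v}"
    using assms by (auto intro: word_cong.refl)
  ultimately have "(\<Union>u'\<in>word_cong A R `` {u}. \<Union>v'\<in>word_cong A R `` {v}.
      word_cong A R `` {u' @ v'}) = word_cong A R `` {u @ v}"
    by blast
  then show ?thesis
    by (simp add: presented_monoid_def)
qed

lemma monoid_presented_monoid: "monoid (presented_monoid A R)"
proof (rule monoidI)
  let ?M = "presented_monoid A R"
  show "x \<otimes>\<^bsub>?M\<^esub> y \<in> carrier ?M" if "x \<in> carrier ?M" "y \<in> carrier ?M" for x y
    using that by (elim presented_monoid_carrierE)
      (simp add: presented_monoid_mult presented_monoid_class_closed)
  show "\<one>\<^bsub>?M\<^esub> \<in> carrier ?M"
    by (simp add: presented_monoid_one presented_monoid_class_closed)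
  show "x \<otimes>\<^bsub>?M\<^esub> y \<otimes>\<^bsub>?M\<^esub> z = x \<otimes>\<^bsub>?M\<^esub> (y \<otimes>\<^bsub>?M\<^esub> z)"
    if "x \<in> carrier ?M" "y \<in> carrier ?M" "z \<in> carrier ?M" for x y z
    using that by (elim presented_monoid_carrierE) (simp add: presented_monoid_mult)
  show "\<one>\<^bsub>?M\<^esub> \<otimes>\<^bsub>?M\<^esub> x = x" if "x \<in> carrier ?M" for x
    using that by (elim presented_monoid_carrierE)
      (simp add: presented_monoid_mult presented_monoid_one)
  show "x \<otimes>\<^bsub>?M\<^esub> \<one>\<^bsub>?M\<^esub> = x" if "x \<in> carrier ?M" for x
    using that by (elim presented_monoid_carrierE)
      (simp add: presented_monoid_mult presented_monoid_one)
qed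

lemma group_presented_monoid:
  assumes inv: "\<And>a. a \<in> A \<Longrightarrow> \<exists>b\<in>A. ([b, a], []) \<in> word_cong A R"
  shows "group (presented_monoid A R)"
proof -
  let ?M = "presented_monoid A R"
  have words: "\<exists>v\<in>lists A. (v @ u, []) \<in> word_cong A R" if "u \<in> lists A" for u
    using that
  proof (induction u)
    case Nil
    then show ?case by (auto intro!: bexI[of _ "[]"] word_cong.refl)
  next
    case (Cons a u)
    then obtain v b where v: "v \<in> lists A" "(v @ u, []) \<in> word_cong A R"
      and b: "b \<in> A" "([b, a], []) \<in> word_cong A R"
      using inv by auto blast
    have "([b, a] @ u, [] @ u) \<in> word_cong A R"
      by (rule word_cong.append[OF b(2) word_cong.refl[OF Cons.hyps(2)]])
    hence "(v @ ([b, a] @ u), v @ ([] @ u)) \<in> word_cong A R"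
      by (rule word_cong.append[OF word_cong.refl[OF v(1)]])
    hence "(v @ [b, a] @ u, []) \<in> word_cong A R"
      using v(2) by (simp only: append_Nil) (rule word_cong.trans)
    hence "((v @ [b]) @ a # u, []) \<in> word_cong A R" by simp
    then show ?case using v b by (intro bexI[of _ "v @ [b]"]) auto
  qed
  interpret monoid ?M by (rule monoid_presented_monoid)
  show ?thesis
  proof (rule groupI)
    fix U assume "U \<in> carrier ?M"
    then obtain u where u: "u \<in> lists A" "U = word_cong A R `` {u}"
      by (rule presented_monoid_carrierE)
    then obtain v where v: "v \<in> lists A" "(v @ u, []) \<in> word_cong A R"
      using words by blast
    show "\<exists>V\<in>carrier ?M. V \<otimes>\<^bsub>?M\<^esub> U = \<one>\<^bsub>?M\<^esub>"
    proof (rule bexI[of _ "word_cong A R `` {v}"])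
      show "word_cong A R `` {v} \<otimes>\<^bsub>?M\<^esub> U = \<one>\<^bsub>?M\<^esub>"
        unfolding u(2) presented_monoid_mult[OF v(1) u(1)] presented_monoid_one
        by (rule equiv_class_eq[OF equiv_word_cong v(2)])
    qed (rule presented_monoid_class_closed[OF v(1)])
  qed (simp_all add: m_assoc)
qed

lemma group_presented_group: "group (presented_group X R)"
  unfolding presented_group_def
proof (rule group_presented_monoid)
  fix a :: "'a \<times> bool" assume a: "a \<in> X \<times> UNIV"
  obtain x b where [simp]: "a = (x, b)" by (cases a)
  have "([(x, \<not> b), (x, \<not> \<not> b)], []) \<in> inverse_relations X \<union> R"
    using a unfolding inverse_relations_def by auto
  then show "\<exists>c\<in>X \<times> UNIV. ([c, a], []) \<in> word_cong (X \<times> UNIV) (inverse_relations X \<union> R)"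
    using a by (intro bexI[of _ "(x, \<not> b)"] word_cong.base) auto
qed

lemma group_free_product:
  assumes "\<And>i. i \<in> I \<Longrightarrow> group (G i)"
  shows "group (free_product I G)"
  unfolding free_product_def
proof (rule group_presented_monoid)
  let ?A = "SIGMA i:I. carrier (G i)" and ?R = "free_product_relations I G"
  fix a assume "a \<in> ?A"
  then obtain i x where a: "a = (i, x)" "i \<in> I" "x \<in> carrier (G i)" by auto
  interpret group "G i" using assms a by blast
  have "([(i, inv\<^bsub>G i\<^esub> x), (i, x)], [(i, \<one>\<^bsub>G i\<^esub>)]) \<in> ?R"
    unfolding free_product_relations_def using a by (auto intro!: exI[of _ i] l_inv[symmetric])
  hence "([(i, inv\<^bsub>G i\<^esub> x), (i, x)], [(i, \<one>\<^bsub>G i\<^esub>)]) \<in> word_cong ?A ?R"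
    using a by (intro word_cong.base) auto
  moreover have "([(i, \<one>\<^bsub>G i\<^esub>)], []) \<in> word_cong ?A ?R"
    using a by (intro word_cong.base) (auto simp: free_product_relations_def)
  ultimately have "([(i, inv\<^bsub>G i\<^esub> x), a], []) \<in> word_cong ?A ?R"
    unfolding a(1) by (rule word_cong.trans)
  then show "\<exists>b\<in>?A. ([b, a], []) \<in> word_cong ?A ?R"
    using a by (intro bexI[of _ "(i, inv\<^bsub>G i\<^esub> x)"]) simp_all
qed

lemma word_value_closed:
  assumes "group H" "\<And>x. x \<in> X \<Longrightarrow> f x \<in> carrier H" "w \<in> lists (X \<times> UNIV)"
  shows "word_value H f w \<in> carrier H"
proof -
  interpret group H by fact
  show ?thesis using assms(3) by (induction w) (auto simp: assms(2))
qed

lemma word_value_append: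
  assumes "group H" "\<And>x. x \<in> X \<Longrightarrow> f x \<in> carrier H"
    and "u \<in> lists (X \<times> UNIV)" "v \<in> lists (X \<times> UNIV)"
  shows "word_value H f (u @ v) = word_value H f u \<otimes>\<^bsub>H\<^esub> word_value H f v"
proof -
  interpret group H by fact
  have closed: "word_value H f w \<in> carrier H" if "w \<in> lists (X \<times> UNIV)" for w
    using word_value_closed[of H X f w] assms(1,2) that by blast
  show ?thesis using assms(3)
  proof (induction u)
    case Nil
    then show ?case using closed[OF assms(4)] by simp
  next
    case (Cons l u)
    then show ?case
      using closed[OF assms(4)] closed[of u] assms(2)[of "fst l"] by (auto simp: m_assoc)
  qed
qed

lemma word_value_cong:
  assumes "group H" "\<And>x. x \<in> X \<Longrightarrow> f x \<in> carrier H"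
    and "\<And>u v. (u, v) \<in> R \<Longrightarrow> word_value H f u = word_value H f v"
    and "(u, v) \<in> word_cong (X \<times> UNIV) (inverse_relations X \<union> R)"
  shows "word_value H f u = word_value H f v"
proof -
  interpret group H by fact
  show ?thesis using assms(4)
  proof (induction rule: word_cong.induct)
    case (base u v)
    then show ?case using assms(2,3) by (auto simp: inverse_relations_def)
  next
    case (append u v u' v')
    then have "u \<in> lists (X \<times> UNIV)" "v \<in> lists (X \<times> UNIV)"
      "u' \<in> lists (X \<times> UNIV)" "v' \<in> lists (X \<times> UNIV)"
      by (auto dest: word_cong_lists)
    with append.IH show ?case
      using word_value_append[of H X f] assms(1,2) by metis
  qed auto
qed

lemma
  assumes "group H" "\<And>x. x \<in> X \<Longrightarrow> f x \<in> carrier H"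
    and "\<And>u v. (u, v) \<in> R \<Longrightarrow> word_value H f u = word_value H f v"
  shows induced_hom_class: "\<And>w. w \<in> lists (X \<times> UNIV) \<Longrightarrow>
      induced_hom H f (word_cong (X \<times> UNIV) (inverse_relations X \<union> R) `` {w})
      = word_value H f w"
    and induced_hom_hom: "induced_hom H f \<in> hom (presented_group X R) H"
proof -
  let ?c = "word_cong (X \<times> UNIV) (inverse_relations X \<union> R)"
  show *: "induced_hom H f (?c `` {w}) = word_value H f w" if "w \<in> lists (X \<times> UNIV)" for w
    unfolding induced_hom_def
  proof (rule the_equality)
    show "\<forall>v\<in>?c `` {w}. word_value H f v = word_value H f w"
      using word_value_cong[of H X f R w] assms by fastforce
    show "h = word_value H f w" if "\<forall>v\<in>?c `` {w}. word_value H f v = h" for h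
      using that word_cong.refl[OF \<open>w \<in> _\<close>, of "inverse_relations X \<union> R"] by fastforce
  qed
  show "induced_hom H f \<in> hom (presented_group X R) H"
    unfolding presented_group_def
  proof (rule homI)
    fix U assume "U \<in> carrier (presented_monoid (X \<times> UNIV) (inverse_relations X \<union> R))"
    then obtain u where u: "u \<in> lists (X \<times> UNIV)" "U = ?c `` {u}"
      by (rule presented_monoid_carrierE)
    then show "induced_hom H f U \<in> carrier H"
      using *[OF u(1)] word_value_closed[of H X f u] assms(1,2) u(1) by simp
    fix V assume "V \<in> carrier (presented_monoid (X \<times> UNIV) (inverse_relations X \<union> R))"
    then obtain v where v: "v \<in> lists (X \<times> UNIV)" "V = ?c `` {v}"
      by (rule presented_monoid_carrierE)
    have "u @ v \<in> lists (X \<times> UNIV)" using u v by auto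
    from *[OF this] *[OF u(1)] *[OF v(1)]
    show "induced_hom H f (U \<otimes>\<^bsub>presented_monoid (X \<times> UNIV) (inverse_relations X \<union> R)\<^esub> V)
        = induced_hom H f U \<otimes>\<^bsub>H\<^esub> induced_hom H f V"
      unfolding u(2) v(2) presented_monoid_mult[OF u(1) v(1)]
      using word_value_append[of H X f u v] assms(1,2) u(1) v(1) by simp
  qed
qed

lemma
  shows planar_braid_perm_hom:
      "planar_braid_perm n \<in> hom (planar_braid_group n) (sym_group n)"
    and planar_braid_perm_generator: "\<And>i. i \<in> {1..<n} \<Longrightarrow>
      planar_braid_perm n (word_cong ({1..<n} \<times> UNIV)
        (inverse_relations {1..<n} \<union> planar_braid_relations n) `` {[(i, True)]})
      = transpose i (i + 1)"
proof -
  let ?f = "\<lambda>i::nat. transpose i (i + 1)"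
  have f: "?f i \<in> carrier (sym_group n)" if "i \<in> {1..<n}" for i
    using that by (auto simp: sym_group_carrier intro!: permutes_swap_id)
  have R: "word_value (sym_group n) ?f u = word_value (sym_group n) ?f v"
    if "(u, v) \<in> planar_braid_relations n" for u v
    using that
    by (auto simp: planar_braid_relations_def sym_group_mult sym_group_one fun_eq_iff
        transpose_def)
  show "planar_braid_perm n \<in> hom (planar_braid_group n) (sym_group n)"
    unfolding planar_braid_perm_def planar_braid_group_def
    by (rule induced_hom_hom[OF sym_group_is_group f R])
  show "planar_braid_perm n (word_cong ({1..<n} \<times> UNIV)
      (inverse_relations {1..<n} \<union> planar_braid_relations n) `` {[(i, True)]})
      = transpose i (i + 1)" if "i \<in> {1..<n}" for i
    unfolding planar_braid_perm_def
    using that by (subst induced_hom_class[where X = "{1..<n}", OF sym_group_is_group f R])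
      (auto simp: sym_group_mult sym_group_one)
qed

lemma group_planar_braid_group: "group (planar_braid_group n)"
  unfolding planar_braid_group_def by (rule group_presented_group)

lemma group_planar_pure_braid_group: "group (planar_pure_braid_group n)"
proof -
  interpret group_hom "planar_braid_group n" "sym_group n" "planar_braid_perm n"
    by (intro group_hom.intro group_hom_axioms.intro group_planar_braid_group
        sym_group_is_group planar_braid_perm_hom)
  show ?thesis
    unfolding planar_pure_braid_group_def
    by (rule G.subgroup_imp_group[OF subgroup_kernel])
qed

end

theory Submission
  imports Defs
begin

text \<open>Join two of the generators \<sigma>1, ..., \<sigma>5 if they commute. The resulting graph is the
  triangle 1, 3, 5 and the square 1, 4, 2, 5 glued along their common edge 1, 5. The planar braid
  group W on six strands is therefore the amalgam of the product of the two infinite dihedral groups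
  generated by \<sigma>1, \<sigma>2 and by \<sigma>4, \<sigma>5 with the elementary abelian group
  generated by \<sigma>1, \<sigma>3, \<sigma>5, over the subgroup generated by \<sigma>1, \<sigma>5.

  The pure braid group P acts on the Bass-Serre tree of this amalgam. The subgroups of order 4 and 8
  embed in the symmetric group, so P meets their conjugates trivially. The product of dihedral groups
  has image of order 36, and P meets it in a free abelian group of rank two generated by
  (\<sigma>2 \<sigma>1)^3 and (\<sigma>4 \<sigma>5)^3. The quotient graph has 720 / 36 = 20 vertices
  with stabiliser Z^2, 720 / 8 = 90 vertices with trivial stabiliser, and 720 / 4 = 180 edges, so a
  spanning tree has 109 edges and leaves 71 edges, each of which contributes a factor Z.

  The proof below carries out this argument without the Bass-Serre tree. Let F be the free product. Each edge of
  the Cayley graph of the symmetric group receives a weight in F such that the boundaries of all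
  squares and all backtracking paths have weight one. Multiplying weights along a braid defines the
  map \<open>transport\<close>, a homomorphism from P to F. In the other direction, the cosets
  that form the quotient graph are lifted to W, coherently along a spanning tree of that graph
  (\<open>compatible_lifts\<close>), and the failure of coherence off the tree and around hexagons
  provides the images in P of the generators of F. The lemmas \<open>psi_transport\<close> and
  \<open>transport_psi\<close> show that the two maps are inverse to each other.\<close>

section \<open>Spanning trees with compatible choices\<close>

text \<open>A tree imposes no constraints between the values chosen at its vertices: a value at one end
  of an edge can always be continued to the other end, and a tree never closes up. Growing a tree
  from the base vertex one edge at a time therefore gives a spanning tree together with a choice of
  values that is compatible along all of its edges. That the tree is spanning and connected is
  expressed by propagation: a vertex set that contains the base vertex and does not separate the ends
  of any tree edge is everything.\<close>

lemma spanning_tree_with_lifts: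
  fixes V :: "'v set" and E :: "'e set" and s t :: "'e \<Rightarrow> 'v"
    and L :: "'v \<Rightarrow> 'l set" and M :: "'e \<Rightarrow> 'l \<Rightarrow> 'l \<Rightarrow> bool"
  assumes fin: "finite V" and base: "v0 \<in> V" "l0 \<in> L v0"
    and ends: "\<And>e. e \<in> E \<Longrightarrow> s e \<in> V \<and> t e \<in> V"
    and conn: "\<And>X. v0 \<in> X \<Longrightarrow> (\<And>e. e \<in> E \<Longrightarrow> s e \<in> X \<longleftrightarrow> t e \<in> X) \<Longrightarrow> V \<subseteq> X"
    and fwd: "\<And>e x. e \<in> E \<Longrightarrow> x \<in> L (s e) \<Longrightarrow> \<exists>y\<in>L (t e). M e x y"
    and bwd: "\<And>e y. e \<in> E \<Longrightarrow> y \<in> L (t e) \<Longrightarrow> \<exists>x\<in>L (s e). M e x y"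
  obtains T l where "T \<subseteq> E" "finite T" "card T + 1 = card V"
    "\<And>X. v0 \<in> X \<Longrightarrow> (\<And>e. e \<in> T \<Longrightarrow> s e \<in> X \<longleftrightarrow> t e \<in> X) \<Longrightarrow> V \<subseteq> X"
    "l v0 = l0" "\<And>v. v \<in> V \<Longrightarrow> l v \<in> L v" "\<And>e. e \<in> T \<Longrightarrow> M e (l (s e)) (l (t e))"
proof -
  define Q where "Q S T l \<longleftrightarrow> v0 \<in> S \<and> S \<subseteq> V \<and> T \<subseteq> E \<and> finite T \<and> card T + 1 = card S
    \<and> (\<forall>X. v0 \<in> X \<longrightarrow> (\<forall>e\<in>T. s e \<in> X \<longleftrightarrow> t e \<in> X) \<longrightarrow> S \<subseteq> X)
    \<and> l v0 = l0 \<and> (\<forall>v\<in>S. l v \<in> L v)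
    \<and> (\<forall>e\<in>T. s e \<in> S \<and> t e \<in> S \<and> M e (l (s e)) (l (t e)))" for S T l
  \<comment> \<open>The tree \<open>T\<close> spans \<open>S\<close>, and \<open>l\<close> is a compatible choice on \<open>S\<close>.\<close>
  have extend: "Q (insert w S) (insert e T) (l(w := y))"
    if "Q S T l" "w \<in> V" "w \<notin> S" "e \<in> E" "y \<in> L w"
      and "s e \<in> S \<and> t e = w \<and> M e (l (s e)) y \<or> t e \<in> S \<and> s e = w \<and> M e y (l (t e))"
    for S T l w e y
  proof -
    have Q: "v0 \<in> S" "S \<subseteq> V" "T \<subseteq> E" "finite T" "card T + 1 = card S"
      "l v0 = l0" "\<forall>v\<in>S. l v \<in> L v" "\<forall>d\<in>T. s d \<in> S \<and> t d \<in> S \<and> M d (l (s d)) (l (t d))"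
      and conn_S: "\<And>X. v0 \<in> X \<Longrightarrow> \<forall>d\<in>T. s d \<in> X \<longleftrightarrow> t d \<in> X \<Longrightarrow> S \<subseteq> X"
      using \<open>Q S T l\<close> unfolding Q_def by blast+
    note link = \<open>s e \<in> S \<and> t e = w \<and> M e (l (s e)) y \<or> t e \<in> S \<and> s e = w \<and> M e y (l (t e))\<close>
    have "\<forall>d\<in>T. s d \<in> S \<and> t d \<in> S" using Q by simp
    then have "e \<notin> T" using \<open>w \<notin> S\<close> link by auto
    moreover have "finite S" using Q fin finite_subset by blast
    ultimately have card: "card (insert e T) + 1 = card (insert w S)"
      using Q \<open>w \<notin> S\<close> by simp
    have conn': "insert w S \<subseteq> X"
      if X: "v0 \<in> X" "\<forall>e\<in>insert e T. s e \<in> X \<longleftrightarrow> t e \<in> X" for X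
    proof -
      have "S \<subseteq> X" using X by (intro conn_S) auto
      then show ?thesis using X(2) link by auto
    qed
    have ne: "v0 \<noteq> w" using Q \<open>w \<notin> S\<close> by auto
    have M': "s d \<in> insert w S \<and> t d \<in> insert w S \<and> M d ((l(w := y)) (s d)) ((l(w := y)) (t d))"
      if "d \<in> insert e T" for d
    proof (cases "d = e")
      case True
      then show ?thesis using link \<open>w \<notin> S\<close> by auto
    next
      case False
      then have "s d \<in> S \<and> t d \<in> S \<and> M d (l (s d)) (l (t d))" using that Q by simp
      moreover from this have "s d \<noteq> w" "t d \<noteq> w" using \<open>w \<notin> S\<close> by auto
      ultimately show ?thesis by simp
    qed
    show ?thesis
      unfolding Q_def
    proof (intro conjI allI impI)
      show "\<forall>v\<in>insert w S. (l(w := y)) v \<in> L v" using Q \<open>y \<in> L w\<close> by simp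
      show "insert w S \<subseteq> X" if "v0 \<in> X" "\<forall>e\<in>insert e T. s e \<in> X \<longleftrightarrow> t e \<in> X" for X
        using that by (rule conn')
      show "\<forall>d\<in>insert e T. s d \<in> insert w S \<and> t d \<in> insert w S
          \<and> M d ((l(w := y)) (s d)) ((l(w := y)) (t d))"
        using M' by blast
    qed (use Q ne card that(2,4) in auto)
  qed
  have step: "\<exists>w T' l'. w \<in> V - S \<and> Q (insert w S) T' l'" if Q: "Q S T l" and "S \<noteq> V" for S T l
  proof -
    have lift: "\<forall>v\<in>S. l v \<in> L v" using Q unfolding Q_def by blast
    have "\<not> V \<subseteq> S" "v0 \<in> S" using that unfolding Q_def by auto
    then have "\<not> (\<forall>e\<in>E. s e \<in> S \<longleftrightarrow> t e \<in> S)" using conn[of S] by blast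
    then obtain e where e: "e \<in> E" "(s e \<in> S) \<noteq> (t e \<in> S)" by blast
    show ?thesis
    proof (cases "s e \<in> S")
      case True
      then obtain y where "y \<in> L (t e)" "M e (l (s e)) y"
        using fwd[OF e(1), of "l (s e)"] lift by auto
      then have "Q (insert (t e) S) (insert e T) (l(t e := y))"
        using True e ends[OF e(1)] by (intro extend[OF Q]) auto
      then show ?thesis using True e ends by blast
    next
      case False
      then obtain y where "y \<in> L (s e)" "M e y (l (t e))"
        using bwd[OF e(1), of "l (t e)"] lift e by auto
      then have "Q (insert (s e) S) (insert e T) (l(s e := y))"
        using False e ends[OF e(1)] by (intro extend[OF Q]) auto
      then show ?thesis using False e ends by blast
    qed
  qed
  have grow: "\<exists>S T l. Q S T l \<and> card S = Suc n" if "n < card V" for n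
    using that
  proof (induction n)
    case 0
    have "Q {v0} {} (\<lambda>_. l0)" using base unfolding Q_def by auto
    then show ?case by (intro exI[of _ "{v0}"] exI) auto
  next
    case (Suc n)
    then obtain S T l where S: "Q S T l" "card S = Suc n" by auto
    then have "S \<noteq> V" using Suc.prems by auto
    then obtain w T' l' where w: "w \<in> V - S" "Q (insert w S) T' l'"
      using step[OF S(1)] by blast
    have "finite S" using S(2) card_gt_0_iff[of S] by simp
    then have "card (insert w S) = Suc (Suc n)" using S w by simp
    then show ?case using w by blast
  qed
  have "card V > 0" using fin base card_gt_0_iff by blast
  then obtain S T l where S: "Q S T l" "card S = card V"
    using grow[of "card V - 1"] by auto
  then have "S \<subseteq> V" by (simp add: Q_def)
  then have "S = V" using S(2) fin by (simp add: card_subset_eq)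
  show thesis
    using S(1) unfolding Q_def \<open>S = V\<close> by (intro that[of T l]) blast+
qed

section \<open>Homomorphisms out of presentations and free products\<close>

lemma presented_monoid_universal:
  assumes "monoid H" and f: "\<And>a. a \<in> A \<Longrightarrow> f a \<in> carrier H"
    and R: "\<And>u v. (u, v) \<in> R \<Longrightarrow> u \<in> lists A \<Longrightarrow> v \<in> lists A \<Longrightarrow>
      foldr (\<lambda>a z. f a \<otimes>\<^bsub>H\<^esub> z) u \<one>\<^bsub>H\<^esub> = foldr (\<lambda>a z. f a \<otimes>\<^bsub>H\<^esub> z) v \<one>\<^bsub>H\<^esub>"
  obtains h where "h \<in> hom (presented_monoid A R) H"
    "\<And>a. a \<in> A \<Longrightarrow> h (word_cong A R `` {[a]}) = f a"
proof -
  interpret monoid H by fact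
  define val where "val w = foldr (\<lambda>a z. f a \<otimes>\<^bsub>H\<^esub> z) w \<one>\<^bsub>H\<^esub>" for w
  have val [simp]: "val [] = \<one>\<^bsub>H\<^esub>" "val (a # w) = f a \<otimes>\<^bsub>H\<^esub> val w" for a w
    by (simp_all add: val_def)
  have closed: "val w \<in> carrier H" if "w \<in> lists A" for w
    using that by induction (auto simp: f)
  have app: "val (u @ v) = val u \<otimes>\<^bsub>H\<^esub> val v" if "u \<in> lists A" "v \<in> lists A" for u v
    using that by (induction u) (auto simp: f closed m_assoc)
  have cong: "val u = val v" if "(u, v) \<in> word_cong A R" for u v
    using that
  proof induction
    case (base u v)
    then show ?case using R by (simp add: val_def)
  next
    case (append u v u' v')
    then have "u \<in> lists A" "v \<in> lists A" "u' \<in> lists A" "v' \<in> lists A"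
      using word_cong_lists by blast+
    with append show ?case by (simp add: app)
  qed auto
  define h where "h U = val (SOME u. u \<in> U)" for U
  have h: "h (word_cong A R `` {w}) = val w" if "w \<in> lists A" for w
  proof -
    have "(SOME u. u \<in> word_cong A R `` {w}) \<in> word_cong A R `` {w}"
      using word_cong.refl[OF that] by (rule_tac someI[of _ w]) simp
    then have "(w, SOME u. u \<in> word_cong A R `` {w}) \<in> word_cong A R" by simp
    then show ?thesis unfolding h_def by (rule cong[symmetric])
  qed
  show thesis
  proof
    show "h \<in> hom (presented_monoid A R) H"
    proof (rule homI)
      fix U V assume UV: "U \<in> carrier (presented_monoid A R)" "V \<in> carrier (presented_monoid A R)"
      obtain u where u: "u \<in> lists A" "U = word_cong A R `` {u}"
        using UV(1) by (rule presented_monoid_carrierE)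
      obtain v where v: "v \<in> lists A" "V = word_cong A R `` {v}"
        using UV(2) by (rule presented_monoid_carrierE)
      from u v show "h (U \<otimes>\<^bsub>presented_monoid A R\<^esub> V) = h U \<otimes>\<^bsub>H\<^esub> h V"
        using h[of "u @ v"] by (simp add: presented_monoid_mult h app)
    qed (erule presented_monoid_carrierE, simp only: h closed)
    show "h (word_cong A R `` {[a]}) = f a" if "a \<in> A" for a
      using that h[of "[a]"] f by simp
  qed
qed

lemma presented_monoid_hom_eqI:
  assumes "f \<in> hom (presented_monoid A R) H" "g \<in> hom (presented_monoid A R) H"
    and one: "f \<one>\<^bsub>presented_monoid A R\<^esub> = g \<one>\<^bsub>presented_monoid A R\<^esub>"
    and letter: "\<And>a. a \<in> A \<Longrightarrow> f (word_cong A R `` {[a]}) = g (word_cong A R `` {[a]})"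
    and U: "U \<in> carrier (presented_monoid A R)"
  shows "f U = g U"
proof -
  obtain u where u: "u \<in> lists A" "U = word_cong A R `` {u}"
    using U by (rule presented_monoid_carrierE)
  have "f (word_cong A R `` {u}) = g (word_cong A R `` {u})"
    using u(1)
  proof induction
    case Nil
    then show ?case using one by (simp add: presented_monoid_one)
  next
    case (Cons a w)
    have "word_cong A R `` {a # w}
        = word_cong A R `` {[a]} \<otimes>\<^bsub>presented_monoid A R\<^esub> word_cong A R `` {w}"
      using Cons by (subst presented_monoid_mult) auto
    then show ?case
      using Cons assms by (simp add: hom_mult presented_monoid_class_closed)
  qed
  then show ?thesis using u by simp
qed

definition free_product_letter ::
    "'i set \<Rightarrow> ('i \<Rightarrow> ('a, 'b) monoid_scheme) \<Rightarrow> 'i \<Rightarrow> 'a \<Rightarrow> ('i \<times> 'a) list set"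
  where "free_product_letter I G i x =
    word_cong (SIGMA i:I. carrier (G i)) (free_product_relations I G) `` {[(i, x)]}"

lemma free_product_letter_hom:
  assumes "i \<in> I" "group (G i)"
  shows "free_product_letter I G i \<in> hom (G i) (free_product I G)"
proof (rule homI)
  interpret group "G i" by fact
  fix x assume x: "x \<in> carrier (G i)"
  then show "free_product_letter I G i x \<in> carrier (free_product I G)"
    using assms by (auto simp: free_product_letter_def free_product_def
      intro: presented_monoid_class_closed)
  fix y assume y: "y \<in> carrier (G i)"
  have "([(i, x), (i, y)], [(i, x \<otimes>\<^bsub>G i\<^esub> y)])
      \<in> word_cong (SIGMA i:I. carrier (G i)) (free_product_relations I G)"
    using assms x y by (intro word_cong.base) (auto simp: free_product_relations_def)
  then show "free_product_letter I G i (x \<otimes>\<^bsub>G i\<^esub> y)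
      = free_product_letter I G i x \<otimes>\<^bsub>free_product I G\<^esub> free_product_letter I G i y"
    using assms x y by (simp add: free_product_letter_def free_product_def
      presented_monoid_mult word_class_eq_iff word_cong.sym)
qed

lemma free_product_universal:
  assumes "group H" and G: "\<And>i. i \<in> I \<Longrightarrow> group (G i)"
    and f: "\<And>i. i \<in> I \<Longrightarrow> f i \<in> hom (G i) H"
  obtains h where "h \<in> hom (free_product I G) H"
    "\<And>i x. i \<in> I \<Longrightarrow> x \<in> carrier (G i) \<Longrightarrow> h (free_product_letter I G i x) = f i x"
proof -
  interpret group H by fact
  let ?A = "SIGMA i:I. carrier (G i)" and ?R = "free_product_relations I G"
  have closed: "f i x \<in> carrier H" if "i \<in> I" "x \<in> carrier (G i)" for i x
    using f[OF that(1)] that(2) by (rule hom_in_carrier)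
  obtain h where "h \<in> hom (presented_monoid ?A ?R) H"
    "\<And>a. a \<in> ?A \<Longrightarrow> h (word_cong ?A ?R `` {[a]}) = (case a of (i, x) \<Rightarrow> f i x)"
  proof (rule presented_monoid_universal[of H ?A "\<lambda>(i, x). f i x" ?R])
    fix u v assume "(u, v) \<in> ?R"
    then show "foldr (\<lambda>a z. (case a of (i, x) \<Rightarrow> f i x) \<otimes>\<^bsub>H\<^esub> z) u \<one>\<^bsub>H\<^esub>
      = foldr (\<lambda>a z. (case a of (i, x) \<Rightarrow> f i x) \<otimes>\<^bsub>H\<^esub> z) v \<one>\<^bsub>H\<^esub>"
      by (auto simp: free_product_relations_def closed hom_one[OF f G] hom_mult[OF f]
        m_assoc[symmetric] monoid.m_closed[OF group.is_monoid[OF G]])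
  qed (auto simp: closed)
  then show thesis
    using that[of h] by (auto simp: free_product_def free_product_letter_def)
qed

lemma free_product_hom_eqI:
  assumes "group H" "\<And>i. i \<in> I \<Longrightarrow> group (G i)"
    and "f \<in> hom (free_product I G) H" "g \<in> hom (free_product I G) H"
    and "\<And>i x. i \<in> I \<Longrightarrow> x \<in> carrier (G i) \<Longrightarrow>
      f (free_product_letter I G i x) = g (free_product_letter I G i x)"
    and "U \<in> carrier (free_product I G)"
  shows "f U = g U"
proof -
  have "f \<one>\<^bsub>free_product I G\<^esub> = g \<one>\<^bsub>free_product I G\<^esub>"
    using hom_one[OF assms(3) _ assms(1)] hom_one[OF assms(4) _ assms(1)]
      group_free_product[of I G] assms(2) by metis
  then show ?thesis
    using assms(5) unfolding free_product_def free_product_letter_def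
    by (intro presented_monoid_hom_eqI[OF assms(3,4)[unfolded free_product_def] _ _
      assms(6)[unfolded free_product_def]]) auto
qed

text \<open>The form in which commutation is passed from generators to products, inverses and powers.\<close>

lemma (in group) subgroup_centralizer:
  assumes u: "u \<in> carrier G"
  shows "subgroup {w \<in> carrier G. w \<otimes> u = u \<otimes> w} G"
proof (rule subgroupI)
  show "{w \<in> carrier G. w \<otimes> u = u \<otimes> w} \<noteq> {}" using u by (auto intro: exI[of _ "\<one>"])
next
  fix v assume "v \<in> {w \<in> carrier G. w \<otimes> u = u \<otimes> w}"
  then have v: "v \<in> carrier G" "v \<otimes> u = u \<otimes> v" by auto
  have "inv v \<otimes> u = inv v \<otimes> (u \<otimes> v) \<otimes> inv v" using u v by (simp add: m_assoc)
  also have "\<dots> = u \<otimes> inv v" using u v(1) by (simp flip: v(2)) (simp add: m_assoc[symmetric])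
  finally show "inv v \<in> {w \<in> carrier G. w \<otimes> u = u \<otimes> w}" using v by simp
next
  fix v w assume "v \<in> {w \<in> carrier G. w \<otimes> u = u \<otimes> w}" "w \<in> {w \<in> carrier G. w \<otimes> u = u \<otimes> w}"
  then show "v \<otimes> w \<in> {w \<in> carrier G. w \<otimes> u = u \<otimes> w}"
    using u by (simp add: m_assoc) (simp flip: m_assoc)
qed auto

lemma free_Abelian_group_pair_hom:
  assumes "group H" "x \<in> carrier H" "y \<in> carrier H" "x \<otimes>\<^bsub>H\<^esub> y = y \<otimes>\<^bsub>H\<^esub> x"
  shows "(\<lambda>c. x [^]\<^bsub>H\<^esub> Poly_Mapping.lookup c i \<otimes>\<^bsub>H\<^esub> y [^]\<^bsub>H\<^esub> Poly_Mapping.lookup c j)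
    \<in> hom (free_Abelian_group S) H"
proof (rule homI)
  interpret group H by fact
  have comm: "y [^]\<^bsub>H\<^esub> (n::int) \<otimes>\<^bsub>H\<^esub> x [^]\<^bsub>H\<^esub> (m::int) = x [^]\<^bsub>H\<^esub> m \<otimes>\<^bsub>H\<^esub> y [^]\<^bsub>H\<^esub> n" for m n
  proof -
    have pow: "v [^]\<^bsub>H\<^esub> k \<otimes>\<^bsub>H\<^esub> u = u \<otimes>\<^bsub>H\<^esub> v [^]\<^bsub>H\<^esub> k"
      if "u \<in> carrier H" "v \<in> carrier H" "u \<otimes>\<^bsub>H\<^esub> v = v \<otimes>\<^bsub>H\<^esub> u" for u v and k :: int
    proof -
      have "subgroup {w \<in> carrier H. w \<otimes>\<^bsub>H\<^esub> u = u \<otimes>\<^bsub>H\<^esub> w} H"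
        using that(1) by (rule subgroup_centralizer)
      from subgroup_int_pow_closed[OF this, of v k] that show ?thesis by simp
    qed
    show ?thesis using assms by (intro pow) (auto simp: pow)
  qed
  fix c d
  show "x [^]\<^bsub>H\<^esub> Poly_Mapping.lookup (c \<otimes>\<^bsub>free_Abelian_group S\<^esub> d) i
      \<otimes>\<^bsub>H\<^esub> y [^]\<^bsub>H\<^esub> Poly_Mapping.lookup (c \<otimes>\<^bsub>free_Abelian_group S\<^esub> d) j
    = (x [^]\<^bsub>H\<^esub> Poly_Mapping.lookup c i \<otimes>\<^bsub>H\<^esub> y [^]\<^bsub>H\<^esub> Poly_Mapping.lookup c j)
      \<otimes>\<^bsub>H\<^esub> (x [^]\<^bsub>H\<^esub> Poly_Mapping.lookup d i \<otimes>\<^bsub>H\<^esub> y [^]\<^bsub>H\<^esub> Poly_Mapping.lookup d j)"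
    using assms(2,3) comm by (simp add: Poly_Mapping.lookup_add int_pow_mult m_assoc)
      (metis comm m_assoc int_pow_closed)
qed (use assms in \<open>auto intro!: monoid.m_closed[OF group.is_monoid] simp: group.int_pow_closed\<close>)

lemma free_Abelian_group_hom_eqI:
  assumes "group H" "f \<in> hom (free_Abelian_group S) H" "g \<in> hom (free_Abelian_group S) H"
    and "\<And>x. x \<in> S \<Longrightarrow> f (frag_of x) = g (frag_of x)"
    and "c \<in> carrier (free_Abelian_group S)"
  shows "f c = g c"
proof -
  interpret H: group H by fact
  interpret f: group_hom "free_Abelian_group S" H f
    by (intro group_hom.intro group_hom_axioms.intro) (use assms in auto)
  interpret g: group_hom "free_Abelian_group S" H g
    by (intro group_hom.intro group_hom_axioms.intro) (use assms in auto)
  have "Poly_Mapping.keys c \<subseteq> S" using assms(5) by simp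
  then have "Poly_Mapping.keys c \<subseteq> S \<and> f c = g c"
  proof (induction rule: frag_induction)
    case zero
    then show ?case using f.hom_one g.hom_one by simp
  next
    case (one x)
    then show ?case using assms(4) by simp
  next
    case (diff a b)
    have "a - b = a \<otimes>\<^bsub>free_Abelian_group S\<^esub> inv\<^bsub>free_Abelian_group S\<^esub> b"
      using diff by simp
    moreover have "Poly_Mapping.keys (a - b) \<subseteq> S"
      using diff keys_diff[of a b] by blast
    moreover have "f (a \<otimes>\<^bsub>free_Abelian_group S\<^esub> inv\<^bsub>free_Abelian_group S\<^esub> b)
        = g (a \<otimes>\<^bsub>free_Abelian_group S\<^esub> inv\<^bsub>free_Abelian_group S\<^esub> b)"
    proof -
      have ab: "a \<in> carrier (free_Abelian_group S)" "b \<in> carrier (free_Abelian_group S)"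
        using diff by auto
      show ?thesis
        using diff by (simp only: f.hom_mult[OF ab(1) f.G.inv_closed[OF ab(2)]]
          g.hom_mult[OF ab(1) f.G.inv_closed[OF ab(2)]] f.hom_inv[OF ab(2)] g.hom_inv[OF ab(2)])
    qed
    ultimately show ?case by metis
  qed
  then show ?thesis ..
qed

section \<open>Arrangements of six strands\<close>

text \<open>Strand positions are numerals throughout, so the position 1 is kept as a numeral too.\<close>

declare One_nat_def [simp del, symmetric, simp]

text \<open>Vertices of the Cayley graph are permutations, read as arrangements of strands; right
  multiplication by a generator exchanges two neighbouring strands.\<close>

definition swap_at :: "(nat \<Rightarrow> 'a) \<Rightarrow> nat \<Rightarrow> nat \<Rightarrow> 'a"
  where "swap_at g i = g \<circ> transpose i (i + 1)"

lemma swap_at_apply: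
  "swap_at g i k = (if k = i then g (i + 1) else if k = i + 1 then g i else g k)"
  by (simp add: swap_at_def transpose_def)

lemma swap_at_swap_at [simp]: "swap_at (swap_at g i) i = g"
  by (auto simp: swap_at_apply fun_eq_iff)

lemma swap_at_commute:
  "\<bar>int i - int j\<bar> > 1 \<Longrightarrow> swap_at (swap_at g i) j = swap_at (swap_at g j) i"
  by (auto simp: swap_at_apply fun_eq_iff)

lemma swap_at_permutes:
  assumes "g permutes {1..n}" "i \<in> {1..<n}"
  shows "swap_at g i permutes {1..n}"
  unfolding swap_at_def using assms by (intro permutes_compose permutes_swap_id) auto

lemma permutes_adjacent_induct [consumes 1, case_names id swap]:
  assumes "p permutes {1..n}" and "P id"
    and step: "\<And>g i. g permutes {1..n} \<Longrightarrow> i \<in> {1..<n} \<Longrightarrow> P g \<Longrightarrow> P (swap_at g i)"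
  shows "P p"
proof -
  have far: "P g \<Longrightarrow> P (g \<circ> transpose a (a + Suc d))"
    if "g permutes {1..n}" "1 \<le> a" "a + Suc d \<le> n" for g a d
    using that
  proof (induction d arbitrary: g)
    case 0
    then have "P (swap_at g a)" using step[of g a] by auto
    then show ?case unfolding swap_at_def Suc_eq_plus1 add_0 .
  next
    case (Suc d)
    let ?b = "a + Suc d"
    \<comment> \<open>A transposition of distant positions is a shorter one conjugated by a swap.\<close>
    let ?h = "swap_at g ?b \<circ> transpose a ?b"
    have perm: "swap_at g ?b permutes {1..n}" "?h permutes {1..n}"
      using Suc.prems by (auto intro!: permutes_compose permutes_swap_id swap_at_permutes)
    have "P ?h"
      by (rule Suc.IH) (use Suc.prems perm step[of g ?b] in auto)
    then have "P (swap_at ?h ?b)" using step[of ?h ?b] perm Suc.prems by simp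
    moreover have "swap_at ?h ?b = g \<circ> transpose a (a + Suc (Suc d))"
      by (auto simp: swap_at_apply fun_eq_iff transpose_def simp flip: Suc_eq_plus1)
    ultimately show ?case by metis
  qed
  have less: "P (g \<circ> transpose a b)" if "g permutes {1..n}" "P g" "1 \<le> a" "a < b" "b \<le> n" for g a b
    using far[of g a "b - a - 1"] that by simp
  show ?thesis
    using finite_atLeastAtMost assms(1,2)
  proof (induction rule: permutes_rev_induct)
    case (swap a b p)
    show ?case
    proof (cases "a < b")
      case True
      show ?thesis by (rule less) (use swap True in auto)
    next
      case False
      have "P (p \<circ> transpose b a)" by (rule less) (use swap False in auto)
      then show ?thesis by (subst transpose_commute)
    qed
  qed
qed

text \<open>Bubble sort with a choice: at every stage the argument may pick, among the descents at
  positions in \<open>J\<close>, one whose removal preserves the property \<open>P\<close>. Each removal puts the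
  larger strand further to the right and so lowers a weighted sum of the entries.\<close>

lemma sort_by_adjacent_swaps:
  assumes "g permutes {1..6}" "P g" "J \<subseteq> {1..<6}"
    and step: "\<And>g. g permutes {1..6} \<Longrightarrow> P g \<Longrightarrow> \<exists>i\<in>J. g (i + 1) < g i \<Longrightarrow>
      \<exists>i\<in>J. g (i + 1) < g i \<and> P (swap_at g i)"
  shows "\<exists>h. h permutes {1..6} \<and> P h \<and> (\<forall>i\<in>J. h i < h (i + 1))"
proof -
  define \<mu> :: "(nat \<Rightarrow> nat) \<Rightarrow> nat" where "\<mu> g = 5 * g 1 + 4 * g 2 + 3 * g 3 + 2 * g 4 + g 5" for g
  show ?thesis
    using assms(1,2)
  proof (induction g rule: measure_induct_rule[of \<mu>])
    case (less g)
    show ?case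
    proof (cases "\<exists>i\<in>J. g (i + 1) < g i")
      case True
      then obtain i where i: "i \<in> J" "g (i + 1) < g i" "P (swap_at g i)"
        using step less.prems by blast
      have "i \<in> {1, 2, 3, 4, 5}" using i(1) assms(3) by auto
      then have "\<mu> (swap_at g i) < \<mu> g"
        using i(2) by (auto simp: \<mu>_def swap_at_apply)
      then show ?thesis
        using less i assms(3) swap_at_permutes by blast
    next
      case False
      have "g i < g (i + 1)" if "i \<in> J" for i
        using False that permutes_inj[OF less.prems(1)] by (metis inj_eq linorder_neqE_nat n_not_Suc_n Suc_eq_plus1)
      then show ?thesis using less.prems by blast
    qed
  qed
qed

text \<open>Invariants that classify the left cosets of three subgroups of the symmetric group: those
  generated by the adjacent transpositions at positions 1, 2, 4, 5, at positions 1, 3, 5, and at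
  positions 1, 5. The first two are the vertices of the quotient graph, the third its edges.\<close>

definition halves :: "(nat \<Rightarrow> nat) \<Rightarrow> nat set \<times> nat set"
  where "halves g = ({g 1, g 2, g 3}, {g 4, g 5, g 6})"

definition pairs :: "(nat \<Rightarrow> nat) \<Rightarrow> nat set \<times> nat set \<times> nat set"
  where "pairs g = ({g 1, g 2}, {g 3, g 4}, {g 5, g 6})"

definition edge_at :: "(nat \<Rightarrow> nat) \<Rightarrow> nat set \<times> nat \<times> nat \<times> nat set"
  where "edge_at g = ({g 1, g 2}, g 3, g 4, {g 5, g 6})"

lemma halves_swap_at: "i \<in> {1, 2, 4, 5} \<Longrightarrow> halves (swap_at g i) = halves g"
  by (auto simp: halves_def swap_at_apply)

lemma pairs_swap_at: "i \<in> {1, 3, 5} \<Longrightarrow> pairs (swap_at g i) = pairs g"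
  by (auto simp: pairs_def swap_at_apply)

lemma edge_at_swap_at: "i \<in> {1, 5} \<Longrightarrow> edge_at (swap_at g i) = edge_at g"
  by (auto simp: edge_at_def swap_at_apply)

lemma permutes_eqI:
  assumes "g permutes {1..6}" "h permutes {1..6}" "\<And>i. i \<in> {1, 2, 3, 4, 5, 6::nat} \<Longrightarrow> g i = h i"
  shows "g = h"
proof
  fix i :: nat
  show "g i = h i"
  proof (cases "i \<in> {1..6}")
    case True
    then have "i \<in> {1, 2, 3, 4, 5, 6}" by auto
    then show ?thesis by (rule assms(3))
  qed (simp add: permutes_not_in[OF assms(1)] permutes_not_in[OF assms(2)])
qed

lemma increasing_triple_eqI:
  fixes a b c x y z :: "'a :: linorder"
  assumes "{a, b, c} = {x, y, z}" "a < b" "b < c" "x < y" "y < z"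
  shows "a = x" "b = y" "c = z"
proof -
  have "sorted [a, b, c]" "distinct [a, b, c]" "sorted [x, y, z]" "distinct [x, y, z]"
    using assms(2-5) by auto
  then have "[a, b, c] = [x, y, z]"
    by (rule sorted_distinct_set_unique) (use assms(1) in simp)
  then show "a = x" "b = y" "c = z" by simp_all
qed

lemma increasing_pair_eqI:
  fixes a b x y :: "'a :: linorder"
  assumes "{a, b} = {x, y}" "a < b" "x < y"
  shows "a = x" "b = y"
proof -
  have "a = x \<and> b = y \<or> a = y \<and> b = x" using assms(1) by (simp add: doubleton_eq_iff)
  then have "a = x \<and> b = y" using assms(2,3) less_asym[of x y] by blast
  then show "a = x" "b = y" by simp_all
qed

text \<open>The swaps at positions 1, 2, 4, 5 connect the arrangements in a coset into a product of two
  hexagons. Opening each hexagon at one edge leaves a path: the edge removed on the left is the swap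
  of the last two strands when the largest of the three is in front, and on the right it is the mirror
  image. The tame swaps are the remaining ones.\<close>

definition tame_swap :: "(nat \<Rightarrow> nat) \<Rightarrow> nat \<Rightarrow> bool"
  where "tame_swap g i \<longleftrightarrow> i = 1 \<or> i = 5
    \<or> i = 2 \<and> \<not> (g 2 < g 1 \<and> g 3 < g 1) \<or> i = 4 \<and> \<not> (g 6 < g 5 \<and> g 6 < g 4)"

text \<open>Removing descents at positions 1 and 5 before those at positions 2 and 4 sorts both halves
  using tame swaps only: once the first descent is gone, the front strand is not the largest.\<close>

lemma halves_connected:
  assumes g: "g permutes {1..6}" and h: "h permutes {1..6}" and eq: "halves g = halves h"
    and step: "\<And>g i. g permutes {1..6} \<Longrightarrow> tame_swap g i \<Longrightarrow> P g \<longleftrightarrow> P (swap_at g i)"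
  shows "P g \<longleftrightarrow> P h"
proof -
  let ?J = "{1, 2, 4, 5} :: nat set"
  have sorted: "\<exists>s. s permutes {1..6} \<and> (halves s = halves g \<and> (P s \<longleftrightarrow> P g))
      \<and> (\<forall>i\<in>?J. s i < s (i + 1))" if "g permutes {1..6}" for g
  proof (rule sort_by_adjacent_swaps[of g "\<lambda>s. halves s = halves g \<and> (P s \<longleftrightarrow> P g)" ?J])
    fix s :: "nat \<Rightarrow> nat"
    assume s: "s permutes {1..6}" "halves s = halves g \<and> (P s \<longleftrightarrow> P g)"
      and "\<exists>i\<in>?J. s (i + 1) < s i"
    then consider "s 2 < s 1" | "s 6 < s 5" | "\<not> s 2 < s 1" "s 3 < s 2" | "\<not> s 6 < s 5" "s 5 < s 4"
      by auto
    then obtain i where i: "i \<in> ?J" "s (i + 1) < s i" "tame_swap s i"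
    proof cases
      case 1
      then show ?thesis by (intro that[of 1]) (simp_all add: tame_swap_def)
    next
      case 2
      then show ?thesis by (intro that[of 5]) (simp_all add: tame_swap_def)
    next
      case 3
      then show ?thesis by (intro that[of 2]) (simp_all add: tame_swap_def)
    next
      case 4
      then show ?thesis by (intro that[of 4]) (simp_all add: tame_swap_def)
    qed
    moreover have "halves (swap_at s i) = halves g" "P (swap_at s i) \<longleftrightarrow> P g"
      using s step[OF s(1) i(3)] halves_swap_at[OF i(1)] by simp_all
    ultimately show "\<exists>i\<in>?J. s (i + 1) < s i \<and> (halves (swap_at s i) = halves g \<and> (P (swap_at s i) \<longleftrightarrow> P g))"
      by blast
  qed (use that in auto)
  obtain s t where s: "s permutes {1..6}" "halves s = halves g" "P s \<longleftrightarrow> P g" "\<forall>i\<in>?J. s i < s (i + 1)"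
    and t: "t permutes {1..6}" "halves t = halves h" "P t \<longleftrightarrow> P h" "\<forall>i\<in>?J. t i < t (i + 1)"
    using sorted[OF g] sorted[OF h] by blast
  have eqs: "{s 1, s 2, s 3} = {t 1, t 2, t 3}" "{s 4, s 5, s 6} = {t 4, t 5, t 6}"
    using s(2) t(2) eq by (simp_all add: halves_def)
  have "s 1 = t 1" "s 2 = t 2" "s 3 = t 3"
    using increasing_triple_eqI[OF eqs(1)] s(4) t(4) by simp_all
  moreover have "s 4 = t 4" "s 5 = t 5" "s 6 = t 6"
    using increasing_triple_eqI[OF eqs(2)] s(4) t(4) by simp_all
  ultimately have "s = t"
    by (intro permutes_eqI[OF s(1) t(1)]) auto
  then show ?thesis using s(3) t(3) by simp
qed

lemma pairs_connected:
  assumes g: "g permutes {1..6}" and h: "h permutes {1..6}" and eq: "pairs g = pairs h"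
    and step: "\<And>g i. g permutes {1..6} \<Longrightarrow> i \<in> {1, 3, 5} \<Longrightarrow> P g \<longleftrightarrow> P (swap_at g i)"
  shows "P g \<longleftrightarrow> P h"
proof -
  let ?J = "{1, 3, 5} :: nat set"
  have sorted: "\<exists>s. s permutes {1..6} \<and> (pairs s = pairs g \<and> (P s \<longleftrightarrow> P g))
      \<and> (\<forall>i\<in>?J. s i < s (i + 1))" if "g permutes {1..6}" for g
  proof (rule sort_by_adjacent_swaps[of g "\<lambda>s. pairs s = pairs g \<and> (P s \<longleftrightarrow> P g)" ?J])
    fix s :: "nat \<Rightarrow> nat"
    assume s: "s permutes {1..6}" "pairs s = pairs g \<and> (P s \<longleftrightarrow> P g)"
      and "\<exists>i\<in>?J. s (i + 1) < s i"
    then obtain i where i: "i \<in> ?J" "s (i + 1) < s i"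
      by blast
    moreover have "pairs (swap_at s i) = pairs g" "P (swap_at s i) \<longleftrightarrow> P g"
      using s step[OF s(1) i(1)] pairs_swap_at[OF i(1)] by simp_all
    ultimately show "\<exists>i\<in>?J. s (i + 1) < s i \<and> (pairs (swap_at s i) = pairs g \<and> (P (swap_at s i) \<longleftrightarrow> P g))"
      by blast
  qed (use that in auto)
  obtain s t where s: "s permutes {1..6}" "pairs s = pairs g" "P s \<longleftrightarrow> P g" "\<forall>i\<in>?J. s i < s (i + 1)"
    and t: "t permutes {1..6}" "pairs t = pairs h" "P t \<longleftrightarrow> P h" "\<forall>i\<in>?J. t i < t (i + 1)"
    using sorted[OF g] sorted[OF h] by blast
  have eqs: "{s 1, s 2} = {t 1, t 2}" "{s 3, s 4} = {t 3, t 4}" "{s 5, s 6} = {t 5, t 6}"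
    using s(2) t(2) eq by (simp_all add: pairs_def)
  have "s 1 = t 1" "s 2 = t 2" "s 3 = t 3" "s 4 = t 4" "s 5 = t 5" "s 6 = t 6"
    using increasing_pair_eqI[OF eqs(1)] increasing_pair_eqI[OF eqs(2)]
      increasing_pair_eqI[OF eqs(3)] s(4) t(4) by simp_all
  then have "s = t"
    by (intro permutes_eqI[OF s(1) t(1)]) auto
  then show ?thesis using s(3) t(3) by simp
qed

lemma edge_at_cases:
  assumes g: "g permutes {1..6}" and h: "h permutes {1..6}" and eq: "edge_at g = edge_at h"
  shows "h \<in> {g, swap_at g 1, swap_at g 5, swap_at (swap_at g 1) 5}"
proof -
  have *: "h = k"
    if "k permutes {1..6}" "h 1 = k 1" "h 2 = k 2" "h 3 = k 3" "h 4 = k 4" "h 5 = k 5" "h 6 = k 6" for k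
    using that by (intro permutes_eqI[OF h that(1)]) auto
  have perm: "swap_at g 1 permutes {1..6}" "swap_at g 5 permutes {1..6}"
    "swap_at (swap_at g 1) 5 permutes {1..6}"
    using g by (auto intro!: swap_at_permutes)
  have mid: "h 3 = g 3" "h 4 = g 4"
    using eq by (simp_all add: edge_at_def)
  have "h 1 = g 1 \<and> h 2 = g 2 \<or> h 1 = g 2 \<and> h 2 = g 1"
    "h 5 = g 5 \<and> h 6 = g 6 \<or> h 5 = g 6 \<and> h 6 = g 5"
    using eq by (auto simp: edge_at_def doubleton_eq_iff)
  then consider "h 1 = g 1" "h 2 = g 2" "h 5 = g 5" "h 6 = g 6" | "h 1 = g 2" "h 2 = g 1" "h 5 = g 5" "h 6 = g 6"
    | "h 1 = g 1" "h 2 = g 2" "h 5 = g 6" "h 6 = g 5" | "h 1 = g 2" "h 2 = g 1" "h 5 = g 6" "h 6 = g 5"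
    by blast
  then show ?thesis
  proof cases
    case 1
    then have "h = g" using mid by (intro *[OF g]) auto
    then show ?thesis by simp
  next
    case 2
    then have "h = swap_at g 1" using mid by (intro *[OF perm(1)]) (auto simp: swap_at_apply)
    then show ?thesis by simp
  next
    case 3
    then have "h = swap_at g 5" using mid by (intro *[OF perm(2)]) (auto simp: swap_at_apply)
    then show ?thesis by simp
  next
    case 4
    then have "h = swap_at (swap_at g 1) 5"
      using mid by (intro *[OF perm(3)]) (auto simp: swap_at_apply)
    then show ?thesis by simp
  qed
qed

lemma edge_connected:
  assumes "g permutes {1..6}" "h permutes {1..6}" "edge_at g = edge_at h"
    and step: "\<And>g i. g permutes {1..6} \<Longrightarrow> i \<in> {1, 5} \<Longrightarrow> P g \<longleftrightarrow> P (swap_at g i)"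
  shows "P g \<longleftrightarrow> P h"
  using edge_at_cases[OF assms(1-3)] step[OF assms(1)] step[OF swap_at_permutes[OF assms(1), of 1]]
  by auto

lemma card_eq_card_image_times:
  assumes "finite A" "\<And>x. x \<in> A \<Longrightarrow> card {y \<in> A. f y = f x} = k"
  shows "card A = card (f ` A) * k"
proof -
  have "card A = (\<Sum>z\<in>f ` A. card {y \<in> A. f y = z})"
    using assms(1) sum.image_gen[of A "\<lambda>_. 1::nat" f] by simp
  also have "\<dots> = (\<Sum>z\<in>f ` A. k)" using assms(2) by (intro sum.cong) auto
  finally show ?thesis by simp
qed

text \<open>The arrangements in a coset of the group of order 8, parametrised by that group.\<close>

definition swap_pairs :: "bool \<times> bool \<times> bool \<Rightarrow> (nat \<Rightarrow> nat) \<Rightarrow> nat \<Rightarrow> nat"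
  where "swap_pairs b g = (case b of (b1, b3, b5) \<Rightarrow>
    (let g1 = if b1 then swap_at g 1 else g; g3 = if b3 then swap_at g1 3 else g1
     in if b5 then swap_at g3 5 else g3))"

lemma swap_pairs_apply:
  "swap_pairs (b1, b3, b5) g 1 = (if b1 then g 2 else g 1)"
  "swap_pairs (b1, b3, b5) g 3 = (if b3 then g 4 else g 3)"
  "swap_pairs (b1, b3, b5) g 5 = (if b5 then g 6 else g 5)"
  by (simp_all add: swap_pairs_def Let_def swap_at_apply)

lemma inj_swap_pairs:
  assumes "g permutes {1..6}"
  shows "inj (\<lambda>b. swap_pairs b g)"
proof (rule injI)
  fix b c assume eq: "swap_pairs b g = swap_pairs c g"
  obtain b1 b3 b5 c1 c3 c5 where bc: "b = (b1, b3, b5)" "c = (c1, c3, c5)"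
    by (cases b; cases c)
  have "g 1 \<noteq> g 2" "g 3 \<noteq> g 4" "g 5 \<noteq> g 6"
    using permutes_inj[OF assms] by (simp_all add: inj_eq)
  then have "b1 = c1" "b3 = c3" "b5 = c5"
    using fun_cong[OF eq, of 1] fun_cong[OF eq, of 3] fun_cong[OF eq, of 5]
    unfolding bc swap_pairs_apply by (auto split: if_splits)
  then show "b = c" using bc by simp
qed

lemma swap_at_swap_pairs:
  assumes "i \<in> {1, 3, 5}"
  shows "swap_at (swap_pairs (b1, b3, b5) g) i
    = swap_pairs (b1 \<noteq> (i = 1), b3 \<noteq> (i = 3), b5 \<noteq> (i = 5)) g"
proof -
  have comm: "swap_at (swap_at k 3) 1 = swap_at (swap_at k 1) 3"
    "swap_at (swap_at k 5) 1 = swap_at (swap_at k 1) 5"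
    "swap_at (swap_at k 5) 3 = swap_at (swap_at k 3) 5" for k :: "nat \<Rightarrow> nat"
    by (simp_all add: swap_at_commute)
  consider "i = 1" | "i = 3" | "i = 5" using assms by auto
  then show ?thesis
    by cases (cases b1; cases b3; cases b5; simp add: swap_pairs_def Let_def comm)+
qed

lemma card_edges: "card (edge_at ` {g. g permutes {1..6}}) = 180"
proof -
  have "card {h \<in> {g. g permutes {1..6}}. edge_at h = edge_at g} = 4"
    if g: "g \<in> {g. g permutes {1..6}}" for g
  proof -
    have "{h \<in> {g. g permutes {1..6}}. edge_at h = edge_at g}
        = {g, swap_at g 1, swap_at g 5, swap_at (swap_at g 1) 5}"
    proof (intro equalityI subsetI)
      fix h assume "h \<in> {h \<in> {g. g permutes {1..6}}. edge_at h = edge_at g}"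
      then show "h \<in> {g, swap_at g 1, swap_at g 5, swap_at (swap_at g 1) 5}"
        using edge_at_cases[of g h] g by simp
    qed (use g in \<open>auto simp: edge_at_swap_at intro!: swap_at_permutes\<close>)
    also have "\<dots> = (\<lambda>b. swap_pairs b g) ` (UNIV \<times> {False} \<times> UNIV)"
      by (force simp: swap_pairs_def Let_def UNIV_bool)
    also have "card \<dots> = card (UNIV \<times> {False} \<times> UNIV :: (bool \<times> bool \<times> bool) set)"
      using inj_swap_pairs g by (intro card_image) (auto intro: inj_on_subset)
    finally show ?thesis by (simp add: card_cartesian_product)
  qed
  from card_eq_card_image_times[OF _ this]
  have "card {g. g permutes {1..6::nat}} = card (edge_at ` {g. g permutes {1..6}}) * 4"
    by (simp add: finite_permutations)
  moreover have "card {g. g permutes {1..6::nat}} = 720"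
    by (subst card_permutations[of _ 6]) (auto simp: fact_numeral)
  ultimately show ?thesis by simp
qed

lemma card_pairs: "card (pairs ` {g. g permutes {1..6}}) = 90"
proof -
  have "card {h \<in> {g. g permutes {1..6}}. pairs h = pairs g} = 8"
    if g: "g \<in> {g. g permutes {1..6}}" for g
  proof -
    let ?R = "range (\<lambda>b. swap_pairs b g)"
    have g_in: "g \<in> ?R"
      by (rule range_eqI[of _ _ "(False, False, False)"]) (simp add: swap_pairs_def)
    have closed: "swap_at k i \<in> ?R" if k: "k \<in> ?R" and i: "i \<in> {1, 3, 5}" for k i
    proof -
      obtain b where "k = swap_pairs b g" using k by blast
      then show ?thesis
        using swap_at_swap_pairs[OF i, of "fst b" "fst (snd b)" "snd (snd b)" g] by simp
    qed
    have step: "k \<in> ?R \<longleftrightarrow> swap_at k i \<in> ?R" if "i \<in> {1, 3, 5}" for k i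
      using closed[OF _ that, of k] closed[OF _ that, of "swap_at k i"]
      unfolding swap_at_swap_at by (rule iffI)
    have "{h \<in> {g. g permutes {1..6}}. pairs h = pairs g} = ?R"
    proof (intro equalityI subsetI)
      fix h assume h: "h \<in> {h \<in> {g. g permutes {1..6}}. pairs h = pairs g}"
      have "g \<in> ?R \<longleftrightarrow> h \<in> ?R"
      proof (rule pairs_connected[where P = "\<lambda>k. k \<in> ?R"])
        show "k \<in> ?R \<longleftrightarrow> swap_at k i \<in> ?R" if "i \<in> {1, 3, 5}" for k i
          using that by (rule step)
      qed (use g h in simp_all)
      then show "h \<in> ?R" using g_in by (rule iffD1)
    next
      fix h assume "h \<in> ?R"
      then obtain b where "h = swap_pairs b g" by blast
      then show "h \<in> {h \<in> {g. g permutes {1..6}}. pairs h = pairs g}"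
        using g by (cases b) (auto simp: swap_pairs_def Let_def pairs_swap_at intro!: swap_at_permutes)
    qed
    also have "card \<dots> = card (UNIV :: (bool \<times> bool \<times> bool) set)"
      using inj_swap_pairs g by (intro card_image) auto
    finally show ?thesis by (simp add: card_cartesian_product flip: UNIV_Times_UNIV)
  qed
  from card_eq_card_image_times[OF _ this]
  have "card {g. g permutes {1..6::nat}} = card (pairs ` {g. g permutes {1..6}}) * 8"
    by (simp add: finite_permutations)
  moreover have "card {g. g permutes {1..6::nat}} = 720"
    by (subst card_permutations[of _ 6]) (auto simp: fact_numeral)
  ultimately show ?thesis by simp
qed

lemma card_halves: "card (halves ` {g. g permutes {1..6}}) = 20"
proof -
  have "halves ` {g. g permutes {1..6}} = (\<lambda>A. (A, {1..6} - A)) ` {A. A \<subseteq> {1..6} \<and> card A = 3}"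
  proof (intro equalityI subsetI)
    fix v assume "v \<in> halves ` {g. g permutes {1..6}}"
    then obtain g where g: "g permutes {1..6}" "v = halves g" by blast
    have "inj g" using g(1) by (rule permutes_inj)
    have "g ` ({1..6} - {1, 2, 3}) = g ` {1..6} - g ` {1, 2, 3}"
      using \<open>inj g\<close> by (rule image_set_diff)
    also have "{1..6} - {1, 2, 3::nat} = {4, 5, 6}" by auto
    finally have "{g 4, g 5, g 6} = {1..6} - {g 1, g 2, g 3}"
      using permutes_image[OF g(1)] by simp
    moreover have "card (g ` {1, 2, 3}) = card {1, 2, 3::nat}"
      using inj_on_subset[OF \<open>inj g\<close> subset_UNIV] by (rule card_image)
    moreover have "g ` {1, 2, 3} \<subseteq> {1..6}"
      using permutes_image[OF g(1)] by auto
    ultimately show "v \<in> (\<lambda>A. (A, {1..6} - A)) ` {A. A \<subseteq> {1..6} \<and> card A = 3}"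
      unfolding g(2) halves_def by (intro image_eqI[of _ _ "g ` {1, 2, 3}"]) auto
  next
    fix v assume "v \<in> (\<lambda>A. (A, {1..6::nat} - A)) ` {A. A \<subseteq> {1..6} \<and> card A = 3}"
    then obtain A where A: "A \<subseteq> {1..6}" "card A = 3" "v = (A, {1..6} - A)" by blast
    have fin: "finite A" using A(1) finite_subset by blast
    obtain f where f: "bij_betw f {1, 2, 3::nat} A"
      using finite_same_card_bij[of "{1, 2, 3::nat}" A] fin A(2) by auto
    obtain f' where f': "bij_betw f' {4, 5, 6::nat} ({1..6} - A)"
      using finite_same_card_bij[of "{4, 5, 6::nat}" "{1..6} - A"] A by (auto simp: card_Diff_subset fin)
    define g where "g k = (if k \<in> {1, 2, 3} then f k else if k \<in> {4, 5, 6} then f' k else k)" for k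
    have "bij_betw g {1, 2, 3} A" using f by (rule bij_betw_cong[THEN iffD1, rotated]) (simp add: g_def)
    moreover have "bij_betw g {4, 5, 6} ({1..6} - A)"
      using f' by (rule bij_betw_cong[THEN iffD1, rotated]) (auto simp: g_def)
    ultimately have "bij_betw g ({1, 2, 3} \<union> {4, 5, 6}) (A \<union> ({1..6} - A))"
      by (rule bij_betw_combine) auto
    moreover have "{1, 2, 3} \<union> {4, 5, 6} = {1..6::nat}" "A \<union> ({1..6} - A) = {1..6}"
      using A(1) by auto
    ultimately have "bij_betw g {1..6} {1..6}" by simp
    then have "g permutes {1..6}" by (rule bij_imp_permutes) (auto simp: g_def)
    moreover have "halves g = v"
      using bij_betw_imp_surj_on[OF f] bij_betw_imp_surj_on[OF f']
      by (simp add: halves_def g_def A(3))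
    ultimately show "v \<in> halves ` {g. g permutes {1..6}}" by blast
  qed
  moreover have "inj_on (\<lambda>A. (A, {1..6} - A)) {A. A \<subseteq> {1..6::nat} \<and> card A = 3}"
    by (auto intro: inj_onI)
  ultimately have "card (halves ` {g. g permutes {1..6}}) = card {A. A \<subseteq> {1..6::nat} \<and> card A = 3}"
    by (simp add: card_image)
  also have "\<dots> = 20"
    using binomial_fact_lemma[of 3 6] by (simp add: n_subsets fact_numeral)
  finally show ?thesis .
qed

section \<open>Planar braids and cocycles\<close>

definition braid_class :: "nat \<Rightarrow> (nat \<times> bool) list \<Rightarrow> (nat \<times> bool) list set"
  where "braid_class n w =
    word_cong ({1..<n} \<times> UNIV) (inverse_relations {1..<n} \<union> planar_braid_relations n) `` {w}"

definition braid_generator :: "nat \<Rightarrow> nat \<Rightarrow> (nat \<times> bool) list set"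
  where "braid_generator n i = braid_class n [(i, True)]"

lemma braid_class_closed:
  "w \<in> lists ({1..<n} \<times> UNIV) \<Longrightarrow> braid_class n w \<in> carrier (planar_braid_group n)"
  unfolding planar_braid_group_def presented_group_def braid_class_def
  by (rule presented_monoid_class_closed)

lemma braid_class_append:
  assumes "u \<in> lists ({1..<n} \<times> UNIV)" "v \<in> lists ({1..<n} \<times> UNIV)"
  shows "braid_class n (u @ v) = braid_class n u \<otimes>\<^bsub>planar_braid_group n\<^esub> braid_class n v"
  unfolding planar_braid_group_def presented_group_def braid_class_def
  using presented_monoid_mult[OF assms] by simp

lemma braid_class_Nil: "braid_class n [] = \<one>\<^bsub>planar_braid_group n\<^esub>"
  by (simp add: planar_braid_group_def presented_group_def braid_class_def presented_monoid_one)

lemma braid_class_eqI: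
  assumes "(u, v) \<in> inverse_relations {1..<n} \<union> planar_braid_relations n"
    and "u \<in> lists ({1..<n} \<times> UNIV)" "v \<in> lists ({1..<n} \<times> UNIV)"
  shows "braid_class n u = braid_class n v"
  unfolding braid_class_def using assms by (simp add: word_class_eq_iff word_cong.base)

lemma braid_generator_closed:
  "i \<in> {1..<n} \<Longrightarrow> braid_generator n i \<in> carrier (planar_braid_group n)"
  unfolding braid_generator_def by (rule braid_class_closed) simp

lemma braid_generator_square:
  assumes "i \<in> {1..<n}"
  shows "braid_generator n i \<otimes>\<^bsub>planar_braid_group n\<^esub> braid_generator n i = \<one>\<^bsub>planar_braid_group n\<^esub>"
proof -
  have "braid_class n [(i, True), (i, True)] = braid_class n []"
    using assms by (intro braid_class_eqI) (auto simp: planar_braid_relations_def)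
  then show ?thesis
    using assms braid_class_append[of "[(i, True)]" n "[(i, True)]"]
    by (simp add: braid_generator_def braid_class_Nil)
qed

lemma braid_generator_commute:
  assumes "i \<in> {1..<n}" "j \<in> {1..<n}" "\<bar>int i - int j\<bar> > 1"
  shows "braid_generator n i \<otimes>\<^bsub>planar_braid_group n\<^esub> braid_generator n j
    = braid_generator n j \<otimes>\<^bsub>planar_braid_group n\<^esub> braid_generator n i"
proof -
  have "braid_class n [(i, True), (j, True)] = braid_class n [(j, True), (i, True)]"
    using assms by (intro braid_class_eqI) (auto simp: planar_braid_relations_def)
  then show ?thesis
    using assms braid_class_append[of "[(i, True)]" n "[(j, True)]"]
      braid_class_append[of "[(j, True)]" n "[(i, True)]"]
    by (simp add: braid_generator_def)
qed

text \<open>The generators are involutions, so a letter and its formal inverse define the same braid.\<close>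

lemma braid_class_letter:
  assumes "i \<in> {1..<n}"
  shows "braid_class n [(i, b)] = braid_generator n i"
proof (cases b)
  case False
  interpret group "planar_braid_group n" by (rule group_planar_braid_group)
  have "braid_class n [(i, True), (i, False)] = braid_class n []"
    using assms by (intro braid_class_eqI) (auto simp: inverse_relations_def)
  then have "braid_generator n i \<otimes>\<^bsub>planar_braid_group n\<^esub> braid_class n [(i, False)]
      = \<one>\<^bsub>planar_braid_group n\<^esub>"
    using assms braid_class_append[of "[(i, True)]" n "[(i, False)]"]
    by (simp add: braid_generator_def braid_class_Nil)
  then have "braid_generator n i \<otimes>\<^bsub>planar_braid_group n\<^esub> braid_class n [(i, False)]
      = braid_generator n i \<otimes>\<^bsub>planar_braid_group n\<^esub> braid_generator n i"
    using braid_generator_square[OF assms] by simp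
  moreover have "braid_class n [(i, False)] \<in> carrier (planar_braid_group n)"
    using assms by (intro braid_class_closed) simp
  ultimately show ?thesis
    using assms False by (simp add: braid_generator_closed)
qed (simp add: braid_generator_def)

lemma braid_class_snoc:
  assumes "w \<in> lists ({1..<n} \<times> UNIV)" "i \<in> {1..<n}"
  shows "braid_class n (w @ [(i, b)])
    = braid_class n w \<otimes>\<^bsub>planar_braid_group n\<^esub> braid_generator n i"
  using braid_class_append[of w n "[(i, b)]"] assms by (simp add: braid_class_letter)

lemma braid_group_cases:
  assumes "U \<in> carrier (planar_braid_group n)"
  obtains w where "w \<in> lists ({1..<n} \<times> UNIV)" "U = braid_class n w"
  using assms unfolding planar_braid_group_def presented_group_def braid_class_def
  by (rule presented_monoid_carrierE)

lemma braid_group_induct [consumes 1, case_names one mult]: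
  assumes "U \<in> carrier (planar_braid_group n)" and "P \<one>\<^bsub>planar_braid_group n\<^esub>"
    and step: "\<And>U i. U \<in> carrier (planar_braid_group n) \<Longrightarrow> i \<in> {1..<n} \<Longrightarrow> P U \<Longrightarrow>
      P (U \<otimes>\<^bsub>planar_braid_group n\<^esub> braid_generator n i)"
  shows "P U"
proof -
  obtain w where w: "w \<in> lists ({1..<n} \<times> UNIV)" "U = braid_class n w"
    using assms(1) by (rule braid_group_cases)
  have "P (braid_class n w)" using w(1)
  proof (induction w rule: rev_induct)
    case Nil
    then show ?case using assms(2) by (simp add: braid_class_Nil)
  next
    case (snoc l w)
    then have "w \<in> lists ({1..<n} \<times> UNIV)" "fst l \<in> {1..<n}" by auto
    then show ?case
      using step[OF braid_class_closed, of w "fst l"] snoc.IH braid_class_snoc[of w n "fst l" "snd l"]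
      by simp
  qed
  then show ?thesis using w by simp
qed

lemma planar_braid_perm_permutes:
  "U \<in> carrier (planar_braid_group n) \<Longrightarrow> planar_braid_perm n U permutes {1..n}"
  using hom_in_carrier[OF planar_braid_perm_hom] by (simp add: sym_group_carrier)

lemma planar_braid_perm_mult:
  assumes "U \<in> carrier (planar_braid_group n)" "V \<in> carrier (planar_braid_group n)"
  shows "planar_braid_perm n (U \<otimes>\<^bsub>planar_braid_group n\<^esub> V) = planar_braid_perm n U \<circ> planar_braid_perm n V"
  using hom_mult[OF planar_braid_perm_hom assms] by (simp add: sym_group_mult)

lemma planar_braid_perm_one: "planar_braid_perm n \<one>\<^bsub>planar_braid_group n\<^esub> = id"
  using hom_one[OF planar_braid_perm_hom group_planar_braid_group sym_group_is_group]
  by (simp add: sym_group_one)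

lemma planar_braid_perm_mult_generator:
  assumes "U \<in> carrier (planar_braid_group n)" "i \<in> {1..<n}"
  shows "planar_braid_perm n (U \<otimes>\<^bsub>planar_braid_group n\<^esub> braid_generator n i)
    = swap_at (planar_braid_perm n U) i"
  using assms planar_braid_perm_generator[OF assms(2)]
  by (simp add: planar_braid_perm_mult braid_generator_closed swap_at_def)
    (simp add: braid_generator_def braid_class_def)

text \<open>A word is a path in the Cayley graph. The weights of its edges are multiplied in order; an
  edge does not depend on whether it is traversed by a generator or by its inverse.\<close>

primrec path_end :: "(nat \<times> bool) list \<Rightarrow> (nat \<Rightarrow> nat) \<Rightarrow> nat \<Rightarrow> nat"
  where
    "path_end [] g = g"
  | "path_end (l # w) g = path_end w (swap_at g (fst l))"

primrec path_value ::
    "('f, 'c) monoid_scheme \<Rightarrow> ((nat \<Rightarrow> nat) \<Rightarrow> nat \<Rightarrow> 'f) \<Rightarrow> (nat \<times> bool) list \<Rightarrow> (nat \<Rightarrow> nat) \<Rightarrow> 'f"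
  where
    "path_value F c [] g = \<one>\<^bsub>F\<^esub>"
  | "path_value F c (l # w) g = c g (fst l) \<otimes>\<^bsub>F\<^esub> path_value F c w (swap_at g (fst l))"

text \<open>The last two conditions say that backtracking along an edge and going around a commutation
  square have weight one. They are exactly what is needed for the weight of a path to depend only on
  its starting point and on the braid that it represents.\<close>

locale braid_cocycle = group F for F (structure) +
  fixes n :: nat and c :: "(nat \<Rightarrow> nat) \<Rightarrow> nat \<Rightarrow> 'a"
  assumes c_closed: "g permutes {1..n} \<Longrightarrow> i \<in> {1..<n} \<Longrightarrow> c g i \<in> carrier F"
    and c_back: "g permutes {1..n} \<Longrightarrow> i \<in> {1..<n} \<Longrightarrow> c g i \<otimes> c (swap_at g i) i = \<one>"
    and c_square: "g permutes {1..n} \<Longrightarrow> i \<in> {1..<n} \<Longrightarrow> j \<in> {1..<n} \<Longrightarrow> \<bar>int i - int j\<bar> > 1 \<Longrightarrow>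
      c g i \<otimes> c (swap_at g i) j = c g j \<otimes> c (swap_at g j) i"
begin

abbreviation "W \<equiv> planar_braid_group n"

lemma path_end_permutes:
  "w \<in> lists ({1..<n} \<times> UNIV) \<Longrightarrow> g permutes {1..n} \<Longrightarrow> path_end w g permutes {1..n}"
proof (induction w arbitrary: g)
  case (Cons l w)
  then have "swap_at g (fst l) permutes {1..n}" by (intro swap_at_permutes) auto
  then show ?case using Cons by simp
qed simp

lemma path_value_closed:
  "w \<in> lists ({1..<n} \<times> UNIV) \<Longrightarrow> g permutes {1..n} \<Longrightarrow> path_value F c w g \<in> carrier F"
proof (induction w arbitrary: g)
  case (Cons l w)
  then have "swap_at g (fst l) permutes {1..n}" "c g (fst l) \<in> carrier F"
    by (auto intro!: swap_at_permutes c_closed simp del: atLeastLessThan_iff)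
  then show ?case using Cons by simp
qed simp

lemma path_end_append: "path_end (u @ v) g = path_end v (path_end u g)"
  by (induction u arbitrary: g) auto

lemma path_value_append:
  assumes "u \<in> lists ({1..<n} \<times> UNIV)" "v \<in> lists ({1..<n} \<times> UNIV)" "g permutes {1..n}"
  shows "path_value F c (u @ v) g = path_value F c u g \<otimes> path_value F c v (path_end u g)"
  using assms(1,3)
proof (induction u arbitrary: g)
  case Nil
  then show ?case using path_value_closed[OF assms(2)] by simp
next
  case (Cons l u)
  then have "fst l \<in> {1..<n}" and u: "u \<in> lists ({1..<n} \<times> UNIV)" by auto
  then have "swap_at g (fst l) permutes {1..n}" "c g (fst l) \<in> carrier F"
    using Cons.prems by (simp_all add: swap_at_permutes c_closed del: atLeastLessThan_iff)
  then show ?case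
    using Cons.IH path_value_closed[OF u] path_value_closed[OF assms(2) path_end_permutes[OF u]]
    by (simp add: m_assoc)
qed

lemma path_cong:
  assumes "(u, v) \<in> word_cong ({1..<n} \<times> UNIV) (inverse_relations {1..<n} \<union> planar_braid_relations n)"
    and "g permutes {1..n}"
  shows "path_end u g = path_end v g \<and> path_value F c u g = path_value F c v g"
  using assms
proof (induction arbitrary: g rule: word_cong.induct)
  case (base u v)
  have closed: "c g i \<otimes> (c (swap_at g i) j \<otimes> \<one>) = c g i \<otimes> c (swap_at g i) j"
    if "i \<in> {1..<n}" "j \<in> {1..<n}" for i j
    using c_closed[OF swap_at_permutes, OF base.prems that] by simp
  from base show ?case
    unfolding inverse_relations_def planar_braid_relations_def
    by (auto simp: closed c_back c_square swap_at_commute simp del: r_one)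
next
  case (append u v u' v')
  then have "u \<in> lists ({1..<n} \<times> UNIV)" "v \<in> lists ({1..<n} \<times> UNIV)"
    "u' \<in> lists ({1..<n} \<times> UNIV)" "v' \<in> lists ({1..<n} \<times> UNIV)"
    by (auto dest: word_cong_lists)
  with append show ?case by (simp add: path_end_append path_value_append path_end_permutes)
qed auto

definition transport :: "(nat \<Rightarrow> nat) \<Rightarrow> (nat \<times> bool) list set \<Rightarrow> 'a"
  where "transport g U = path_value F c (SOME w. w \<in> U) g"

lemma transport_class:
  assumes "w \<in> lists ({1..<n} \<times> UNIV)" "g permutes {1..n}"
  shows "transport g (braid_class n w) = path_value F c w g"
proof -
  have "(SOME v. v \<in> braid_class n w) \<in> braid_class n w"
    using word_cong.refl[OF assms(1)] by (rule_tac someI[of _ w]) (simp add: braid_class_def)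
  then have "(w, SOME v. v \<in> braid_class n w)
      \<in> word_cong ({1..<n} \<times> UNIV) (inverse_relations {1..<n} \<union> planar_braid_relations n)"
    by (simp add: braid_class_def)
  from path_cong[OF this assms(2)] show ?thesis by (simp add: transport_def)
qed

lemma path_end_eq:
  assumes "w \<in> lists ({1..<n} \<times> UNIV)"
  shows "path_end w g = g \<circ> planar_braid_perm n (braid_class n w)"
  using assms
proof (induction w rule: rev_induct)
  case Nil
  then show ?case by (simp add: braid_class_Nil planar_braid_perm_one)
next
  case (snoc l w)
  then have w: "w \<in> lists ({1..<n} \<times> UNIV)" and l: "fst l \<in> {1..<n}" by auto
  have "planar_braid_perm n (braid_class n (w @ [l]))
      = swap_at (planar_braid_perm n (braid_class n w)) (fst l)"
    using braid_class_snoc[OF w l, of "snd l"]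
      planar_braid_perm_mult_generator[OF braid_class_closed[OF w] l] by simp
  then show ?case using snoc.IH[OF w] by (simp add: path_end_append swap_at_def o_assoc)
qed

lemma transport_closed:
  assumes "U \<in> carrier W" "g permutes {1..n}"
  shows "transport g U \<in> carrier F"
  using assms(1) by (rule braid_group_cases) (simp add: transport_class path_value_closed assms(2))

lemma transport_one: "g permutes {1..n} \<Longrightarrow> transport g \<one>\<^bsub>W\<^esub> = \<one>"
  using transport_class[of "[]" g] by (simp add: braid_class_Nil)

text \<open>The cocycle identity. It makes the transport from the identity multiplicative on braids whose
  first factor is pure.\<close>

lemma transport_mult:
  assumes "U \<in> carrier W" "V \<in> carrier W" "g permutes {1..n}"
  shows "transport g (U \<otimes>\<^bsub>W\<^esub> V) = transport g U \<otimes> transport (g \<circ> planar_braid_perm n U) V"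
proof -
  obtain u v where u: "u \<in> lists ({1..<n} \<times> UNIV)" "U = braid_class n u"
    and v: "v \<in> lists ({1..<n} \<times> UNIV)" "V = braid_class n v"
    using assms(1,2) by (metis braid_group_cases)
  have "u @ v \<in> lists ({1..<n} \<times> UNIV)" using u v by simp
  moreover have "g \<circ> planar_braid_perm n U permutes {1..n}"
    using planar_braid_perm_permutes[OF assms(1)] assms(3) by (rule permutes_compose)
  ultimately show ?thesis
    using path_value_append[OF u(1) v(1) assms(3)] u v assms(3)
    by (simp add: braid_class_append[OF u(1) v(1), symmetric] transport_class path_end_eq)
qed

lemma transport_mult_generator:
  assumes "U \<in> carrier W" "i \<in> {1..<n}" "g permutes {1..n}"
  shows "transport g (U \<otimes>\<^bsub>W\<^esub> braid_generator n i) = transport g U \<otimes> c (g \<circ> planar_braid_perm n U) i"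
proof -
  have perm: "g \<circ> planar_braid_perm n U permutes {1..n}"
    using planar_braid_perm_permutes[OF assms(1)] assms(3) by (rule permutes_compose)
  then have "transport (g \<circ> planar_braid_perm n U) (braid_generator n i) = c (g \<circ> planar_braid_perm n U) i"
    using assms(2) transport_class[of "[(i, True)]" "g \<circ> planar_braid_perm n U"]
      c_closed[OF perm assms(2)] by (simp add: braid_generator_def)
  then show ?thesis
    using transport_mult[OF assms(1) braid_generator_closed[OF assms(2)] assms(3)] by simp
qed

end

section \<open>One hexagon: dihedral sections\<close>

context group
begin

text \<open>A reduced expression, in the dihedral group generated by \<open>p\<close> and \<open>q\<close>, of the
  arrangement with entries \<open>x\<close>, \<open>y\<close>, \<open>z\<close>: the second factor records the order of the
  first two entries and the first factor the place of the third. The pattern 3, 2, 1 has two reduced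
  expressions; choosing \<open>p q p\<close> opens the hexagon of arrangements at the edge from 3, 2, 1 to
  3, 1, 2.\<close>

definition dihedral_section :: "'a \<Rightarrow> 'a \<Rightarrow> int \<Rightarrow> int \<Rightarrow> int \<Rightarrow> 'a"
  where "dihedral_section p q x y z =
    (if x < z \<and> y < z then \<one> else if x < z \<or> y < z then q else p \<otimes> q)
      \<otimes> (if x < y then \<one> else p)"

lemma dihedral_section_closed:
  "p \<in> carrier G \<Longrightarrow> q \<in> carrier G \<Longrightarrow> dihedral_section p q x y z \<in> carrier G"
  by (simp add: dihedral_section_def)

lemma dihedral_section_centralizer:
  assumes "p \<in> carrier G" "q \<in> carrier G" "u \<in> carrier G" "p \<otimes> u = u \<otimes> p" "q \<otimes> u = u \<otimes> q"
  shows "dihedral_section p q x y z \<otimes> u = u \<otimes> dihedral_section p q x y z"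
proof -
  define C where "C = {w \<in> carrier G. w \<otimes> u = u \<otimes> w}"
  have "subgroup C G" unfolding C_def using assms(3) by (rule subgroup_centralizer)
  moreover have "p \<in> C" "q \<in> C" unfolding C_def using assms by auto
  ultimately have "dihedral_section p q x y z \<in> C"
    by (simp add: dihedral_section_def subgroup.m_closed subgroup.one_closed)
  then show ?thesis by (simp add: C_def)
qed

lemma dihedral_section_swap_first:
  assumes "p \<in> carrier G" "q \<in> carrier G" "p \<otimes> p = \<one>" "x \<noteq> y"
  shows "dihedral_section p q y x z = dihedral_section p q x y z \<otimes> p"
  using assms by (auto simp: dihedral_section_def m_assoc)

lemma dihedral_section_swap_last:
  assumes "p \<in> carrier G" "q \<in> carrier G" "q \<otimes> q = \<one>"
    and "x \<noteq> y" "x \<noteq> z" "y \<noteq> z" "\<not> (y < x \<and> z < x)"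
  shows "dihedral_section p q x z y = dihedral_section p q x y z \<otimes> q"
  using assms by (auto simp: dihedral_section_def m_assoc)

definition hexagon_loop :: "'a \<Rightarrow> 'a \<Rightarrow> 'a"
  where "hexagon_loop p q = q \<otimes> p \<otimes> q \<otimes> p \<otimes> q \<otimes> p"

lemma hexagon_loop_closed:
  "p \<in> carrier G \<Longrightarrow> q \<in> carrier G \<Longrightarrow> hexagon_loop p q \<in> carrier G"
  by (simp add: hexagon_loop_def)

lemma hexagon_loop_centralizer:
  assumes "p \<in> carrier G" "q \<in> carrier G" "u \<in> carrier G" "p \<otimes> u = u \<otimes> p" "q \<otimes> u = u \<otimes> q"
  shows "hexagon_loop p q \<otimes> u = u \<otimes> hexagon_loop p q"
proof -
  define C where "C = {w \<in> carrier G. w \<otimes> u = u \<otimes> w}"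
  have "subgroup C G" unfolding C_def using assms(3) by (rule subgroup_centralizer)
  moreover have "p \<in> C" "q \<in> C" unfolding C_def using assms by auto
  ultimately have "hexagon_loop p q \<in> C"
    by (simp add: hexagon_loop_def subgroup.m_closed)
  then show ?thesis by (simp add: C_def)
qed

text \<open>Across the opened edge of the hexagon the section fails to be compatible with the swap; the
  defect is the full turn around the hexagon.\<close>

lemma dihedral_section_closing:
  assumes "p \<in> carrier G" "q \<in> carrier G" "p \<otimes> p = \<one>" "q \<otimes> q = \<one>"
    and "y < x" "z < x" "y < z"
  shows "dihedral_section p q x y z \<otimes> q
    = hexagon_loop p q \<otimes> dihedral_section p q x z y"
proof -
  have cancel: "p \<otimes> (p \<otimes> u) = u" "q \<otimes> (q \<otimes> u) = u" if "u \<in> carrier G" for u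
    using assms(1-4) that by (simp_all flip: m_assoc)
  show ?thesis
    using assms by (simp add: dihedral_section_def hexagon_loop_def m_assoc cancel)
qed

text \<open>The weight of the swap of the last two entries: a full turn is charged to the opened edge of
  the hexagon, with a sign for the direction of travel, and the other such edges are free.\<close>

definition hexagon_weight :: "'a \<Rightarrow> int \<Rightarrow> int \<Rightarrow> int \<Rightarrow> 'a"
  where "hexagon_weight u x y z = (if y < x \<and> z < x then if y < z then u else inv u else \<one>)"

lemma hexagon_weight_closed: "u \<in> carrier G \<Longrightarrow> hexagon_weight u x y z \<in> carrier G"
  by (simp add: hexagon_weight_def)

lemma hexagon_weight_back:
  "u \<in> carrier G \<Longrightarrow> y \<noteq> z \<Longrightarrow> hexagon_weight u x y z \<otimes> hexagon_weight u x z y = \<one>"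
  by (auto simp: hexagon_weight_def)

lemma hexagon_weight_commute:
  assumes "u \<in> carrier G" "v \<in> carrier G" "u \<otimes> v = v \<otimes> u"
  shows "hexagon_weight u x y z \<otimes> hexagon_weight v x' y' z'
    = hexagon_weight v x' y' z' \<otimes> hexagon_weight u x y z"
proof -
  have "inv u \<otimes> w = w \<otimes> inv u" if "w \<in> carrier G" "u \<otimes> w = w \<otimes> u" for w
    using subgroup.m_inv_closed[OF subgroup_centralizer[OF that(1)], of u] assms(1) that by simp
  moreover have "inv v \<otimes> w = w \<otimes> inv v" if "w \<in> carrier G" "v \<otimes> w = w \<otimes> v" for w
    using subgroup.m_inv_closed[OF subgroup_centralizer[OF that(1)], of v] assms(2) that by simp
  ultimately show ?thesis
    using assms by (simp add: hexagon_weight_def)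
qed

end

section \<open>Weights on the Cayley graph\<close>

text \<open>The element \<open>e g\<close> belongs to the edge of the quotient graph at \<open>g\<close>, and
  \<open>a v\<close>, \<open>b v\<close> are the turns around the left and the right hexagon of the coset
  \<open>v\<close>. A swap at position 3 leaves the coset and passes through a cell with trivial group, so
  its weight is the quotient of the elements of the two edges involved. The right-hand half is the
  mirror image of the left-hand one, whence the reversed order of its entries and their negation.\<close>

locale graph_of_groups_weights = group F for F (structure) +
  fixes e :: "(nat \<Rightarrow> nat) \<Rightarrow> 'a" and a b :: "nat set \<times> nat set \<Rightarrow> 'a"
  assumes e_closed: "g permutes {1..6} \<Longrightarrow> e g \<in> carrier F"
    and e_swap: "g permutes {1..6} \<Longrightarrow> i \<in> {1, 5} \<Longrightarrow> e (swap_at g i) = e g"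
    and ab_closed: "v \<in> halves ` {g. g permutes {1..6}} \<Longrightarrow> a v \<in> carrier F \<and> b v \<in> carrier F"
    and ab_commute: "v \<in> halves ` {g. g permutes {1..6}} \<Longrightarrow> a v \<otimes> b v = b v \<otimes> a v"
begin

definition weight :: "(nat \<Rightarrow> nat) \<Rightarrow> nat \<Rightarrow> 'a"
  where "weight g i =
    (if i = 2 then hexagon_weight (a (halves g)) (int (g 1)) (int (g 2)) (int (g 3))
     else if i = 4 then hexagon_weight (b (halves g)) (- int (g 6)) (- int (g 5)) (- int (g 4))
     else if i = 3 then inv (e g) \<otimes> e (swap_at g 3)
     else \<one>)"

lemma weight_tame: "tame_swap g i \<Longrightarrow> weight g i = \<one>"
  by (auto simp: weight_def tame_swap_def hexagon_weight_def)

text \<open>Only two kinds of squares need an argument: those that involve position 3, where the labels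
  \<open>e\<close> do not change under the swaps at positions 1 and 5, and the one at positions 2 and 4, where
  the two turns of a coset commute.\<close>

sublocale braid_cocycle F 6 weight
proof
  fix g :: "nat \<Rightarrow> nat" and i j :: nat
  assume g: "g permutes {1..6}" and i: "i \<in> {1..<6}"
  have ab: "a (halves g) \<in> carrier F" "b (halves g) \<in> carrier F"
    "a (halves g) \<otimes> b (halves g) = b (halves g) \<otimes> a (halves g)"
    using ab_closed ab_commute g by auto
  have perm: "swap_at g k permutes {1..6}" if "k \<in> {1..<6}" for k
    using g that by (rule swap_at_permutes)
  have e: "e g \<in> carrier F" "e (swap_at g 3) \<in> carrier F"
    using g perm[of 3] by (auto intro: e_closed)
  show "weight g i \<in> carrier F"
    by (simp add: weight_def ab e hexagon_weight_closed)
  have distinct: "g 2 \<noteq> g 3" "g 4 \<noteq> g 5" using permutes_inj[OF g] by (simp_all add: inj_eq)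
  have cancel: "e (swap_at g 3) \<otimes> (inv (e (swap_at g 3)) \<otimes> e g) = e g"
    using e by (simp flip: m_assoc)
  have cases: "i = 1 \<or> i = 2 \<or> i = 3 \<or> i = 4 \<or> i = 5" using i by auto
  then show "weight g i \<otimes> weight (swap_at g i) i = \<one>"
    using ab e distinct
    by (elim disjE) (simp_all add: weight_def swap_at_apply halves_swap_at hexagon_weight_back m_assoc
      cancel)
  assume j: "j \<in> {1..<6}" and far: "\<bar>int i - int j\<bar> > 1"
  have far_commute: "weight g k \<otimes> weight (swap_at g k) l = weight g l \<otimes> weight (swap_at g l) k"
    if "(k, l) \<in> {(1, 3), (1, 4), (1, 5), (2, 4), (2, 5), (3, 5)}" for k l
  proof -
    have comm: "swap_at (swap_at g 3) 1 = swap_at (swap_at g 1) 3"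
      "swap_at (swap_at g 5) 3 = swap_at (swap_at g 3) 5" by (simp_all add: swap_at_commute)
    have "e (swap_at (swap_at g 1) 3) = e (swap_at g 3)" "e (swap_at (swap_at g 5) 3) = e (swap_at g 3)"
      "e (swap_at g 1) = e g" "e (swap_at g 5) = e g"
      using e_swap[OF g] e_swap[OF perm[of 3]] by (simp_all flip: comm(1) add: comm(2))
    then show ?thesis
      using that ab e
      by (elim insertE) (simp_all add: weight_def swap_at_apply halves_swap_at hexagon_weight_closed
        hexagon_weight_commute)
  qed
  have "j = 1 \<or> j = 2 \<or> j = 3 \<or> j = 4 \<or> j = 5" using j by auto
  with cases far have "(i, j) \<in> {(1, 3), (1, 4), (1, 5), (2, 4), (2, 5), (3, 5)}
      \<or> (j, i) \<in> {(1, 3), (1, 4), (1, 5), (2, 4), (2, 5), (3, 5)}"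
    by (elim disjE) simp_all
  then show "weight g i \<otimes> weight (swap_at g i) j = weight g j \<otimes> weight (swap_at g j) i"
    by (elim disjE) (rule far_commute, assumption, rule far_commute[symmetric], assumption)
qed

end

section \<open>Sections over the cosets\<close>

interpretation W: group "planar_braid_group 6"
  by (rule group_planar_braid_group)

abbreviation braid_mult (infixl "\<cdot>" 70)
  where "x \<cdot> y \<equiv> x \<otimes>\<^bsub>planar_braid_group 6\<^esub> y"

abbreviation "\<sigma> \<equiv> braid_generator 6"

abbreviation "\<pi> \<equiv> planar_braid_perm 6"

lemma sigma_closed: "i \<in> {1, 2, 3, 4, 5} \<Longrightarrow> \<sigma> i \<in> carrier (planar_braid_group 6)"
  by (rule braid_generator_closed) auto

lemma sigma_square: "i \<in> {1, 2, 3, 4, 5} \<Longrightarrow> \<sigma> i \<cdot> \<sigma> i = \<one>\<^bsub>planar_braid_group 6\<^esub>"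
  by (rule braid_generator_square) auto

lemma sigma_commute:
  "(i, j) \<in> {(1, 3), (1, 4), (1, 5), (2, 4), (2, 5), (3, 5)} \<Longrightarrow> \<sigma> j \<cdot> \<sigma> i = \<sigma> i \<cdot> \<sigma> j"
  by (rule braid_generator_commute) auto

lemma perm_mult_sigma:
  assumes "x \<in> carrier (planar_braid_group 6)" "i \<in> {1, 2, 3, 4, 5}"
  shows "\<pi> (x \<cdot> \<sigma> i) = swap_at (\<pi> x) i"
  using assms by (intro planar_braid_perm_mult_generator) auto

text \<open>Position of an arrangement relative to the sorted arrangement of its coset, written as a braid.
  The negated and reversed entries express the mirror symmetry that exchanges the generators 1, 2 with
  5, 4.\<close>

definition halves_section :: "(nat \<Rightarrow> nat) \<Rightarrow> (nat \<times> bool) list set"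
  where "halves_section g =
    W.dihedral_section (\<sigma> 1) (\<sigma> 2) (int (g 1)) (int (g 2)) (int (g 3))
    \<cdot> W.dihedral_section (\<sigma> 5) (\<sigma> 4) (- int (g 6)) (- int (g 5)) (- int (g 4))"

definition pairs_section :: "(nat \<Rightarrow> nat) \<Rightarrow> (nat \<times> bool) list set"
  where "pairs_section g =
    (if g 1 < g 2 then \<one>\<^bsub>planar_braid_group 6\<^esub> else \<sigma> 1)
    \<cdot> (if g 3 < g 4 then \<one>\<^bsub>planar_braid_group 6\<^esub> else \<sigma> 3)
    \<cdot> (if g 5 < g 6 then \<one>\<^bsub>planar_braid_group 6\<^esub> else \<sigma> 5)"

lemma halves_section_closed: "halves_section g \<in> carrier (planar_braid_group 6)"
  by (simp add: halves_section_def W.dihedral_section_closed sigma_closed)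

lemma pairs_section_closed: "pairs_section g \<in> carrier (planar_braid_group 6)"
  by (simp add: pairs_section_def sigma_closed)

lemma permutes_adjacent_distinct:
  fixes g :: "nat \<Rightarrow> nat"
  assumes "g permutes {1..6}"
  shows "g 1 \<noteq> g 2" "g 1 \<noteq> g 3" "g 2 \<noteq> g 3" "g 3 \<noteq> g 4" "g 4 \<noteq> g 5" "g 4 \<noteq> g 6" "g 5 \<noteq> g 6"
  using permutes_inj[OF assms] by (simp_all add: inj_eq)

lemma halves_section_tame:
  assumes g: "g permutes {1..6}" and tame: "tame_swap g i"
  shows "halves_section (swap_at g i) = halves_section g \<cdot> \<sigma> i"
proof -
  let ?L = "\<lambda>x y z. W.dihedral_section (\<sigma> 1) (\<sigma> 2) (int x) (int y) (int z)"
  let ?R = "\<lambda>x y z. W.dihedral_section (\<sigma> 5) (\<sigma> 4) (- int x) (- int y) (- int z)"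
  note distinct = permutes_adjacent_distinct[OF g]
  have closed: "?L x y z \<in> carrier (planar_braid_group 6)" "?R x y z \<in> carrier (planar_braid_group 6)" for x y z
    by (simp_all add: W.dihedral_section_closed sigma_closed)
  have comm: "?R x y z \<cdot> \<sigma> i = \<sigma> i \<cdot> ?R x y z" if "i \<in> {1, 2}" for x y z i
    using that by (intro W.dihedral_section_centralizer)
      (auto simp: sigma_closed sigma_commute)
  consider "i = 1" | "i = 2" "\<not> (g 2 < g 1 \<and> g 3 < g 1)" | "i = 4" "\<not> (g 6 < g 5 \<and> g 6 < g 4)" | "i = 5"
    using tame by (auto simp: tame_swap_def)
  then show ?thesis
  proof cases
    case 1
    have "?L (g 2) (g 1) (g 3) = ?L (g 1) (g 2) (g 3) \<cdot> \<sigma> 1"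
      using distinct by (intro W.dihedral_section_swap_first) (simp_all add: sigma_closed sigma_square)
    then show ?thesis
      using 1 by (simp add: halves_section_def swap_at_apply W.m_assoc closed sigma_closed comm)
  next
    case 2
    have "?L (g 1) (g 3) (g 2) = ?L (g 1) (g 2) (g 3) \<cdot> \<sigma> 2"
      using distinct 2 by (intro W.dihedral_section_swap_last) (simp_all add: sigma_closed sigma_square)
    then show ?thesis
      using 2 by (simp add: halves_section_def swap_at_apply W.m_assoc closed sigma_closed comm)
  next
    case 3
    have "?R (g 6) (g 4) (g 5) = ?R (g 6) (g 5) (g 4) \<cdot> \<sigma> 4"
      using distinct 3 by (intro W.dihedral_section_swap_last) (auto simp: sigma_closed sigma_square)
    then show ?thesis
      using 3 by (simp add: halves_section_def swap_at_apply W.m_assoc closed sigma_closed)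
  next
    case 4
    have "?R (g 5) (g 6) (g 4) = ?R (g 6) (g 5) (g 4) \<cdot> \<sigma> 5"
      using distinct by (intro W.dihedral_section_swap_first) (auto simp: sigma_closed sigma_square)
    then show ?thesis
      using 4 by (simp add: halves_section_def swap_at_apply W.m_assoc closed sigma_closed)
  qed
qed

text \<open>The turns around the two hexagons of a coset appear as the defects of the section. In the
  second case the turn must be moved past the left-hand part of the section, with which it commutes.\<close>

lemma halves_section_closing:
  shows "g 2 < g 3 \<Longrightarrow> g 3 < g 1 \<Longrightarrow>
      halves_section g \<cdot> \<sigma> 2 = W.hexagon_loop (\<sigma> 1) (\<sigma> 2) \<cdot> halves_section (swap_at g 2)"
    and "g 6 < g 4 \<Longrightarrow> g 4 < g 5 \<Longrightarrow>
      halves_section g \<cdot> \<sigma> 4 = W.hexagon_loop (\<sigma> 5) (\<sigma> 4) \<cdot> halves_section (swap_at g 4)"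
proof -
  let ?L = "\<lambda>x y z. W.dihedral_section (\<sigma> 1) (\<sigma> 2) (int x) (int y) (int z)"
  let ?R = "\<lambda>x y z. W.dihedral_section (\<sigma> 5) (\<sigma> 4) (- int x) (- int y) (- int z)"
  let ?A = "W.hexagon_loop (\<sigma> 1) (\<sigma> 2)" and ?B = "W.hexagon_loop (\<sigma> 5) (\<sigma> 4)"
  have closed: "?L x y z \<in> carrier (planar_braid_group 6)" "?R x y z \<in> carrier (planar_braid_group 6)"
    "?A \<in> carrier (planar_braid_group 6)" "?B \<in> carrier (planar_braid_group 6)" for x y z
    by (simp_all add: W.dihedral_section_closed W.hexagon_loop_closed sigma_closed)
  show "halves_section g \<cdot> \<sigma> 2 = ?A \<cdot> halves_section (swap_at g 2)" if "g 2 < g 3" "g 3 < g 1"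
  proof -
    have "?R (g 6) (g 5) (g 4) \<cdot> \<sigma> 2 = \<sigma> 2 \<cdot> ?R (g 6) (g 5) (g 4)"
      by (intro W.dihedral_section_centralizer)
        (auto simp: sigma_closed sigma_commute)
    then have "halves_section g \<cdot> \<sigma> 2 = ?L (g 1) (g 2) (g 3) \<cdot> \<sigma> 2 \<cdot> ?R (g 6) (g 5) (g 4)"
      by (simp add: halves_section_def W.m_assoc closed sigma_closed)
    also have "?L (g 1) (g 2) (g 3) \<cdot> \<sigma> 2 = ?A \<cdot> ?L (g 1) (g 3) (g 2)"
      using that by (intro W.dihedral_section_closing) (simp_all add: sigma_closed sigma_square)
    finally show ?thesis
      by (simp add: halves_section_def swap_at_apply W.m_assoc closed)
  qed
  show "halves_section g \<cdot> \<sigma> 4 = ?B \<cdot> halves_section (swap_at g 4)" if "g 6 < g 4" "g 4 < g 5"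
  proof -
    have "?B \<cdot> \<sigma> i = \<sigma> i \<cdot> ?B" if "i \<in> {1, 2}" for i
      using that by (intro W.hexagon_loop_centralizer)
        (auto simp: sigma_closed sigma_commute)
    then have comm: "?L (g 1) (g 2) (g 3) \<cdot> ?B = ?B \<cdot> ?L (g 1) (g 2) (g 3)"
      by (intro W.dihedral_section_centralizer) (simp_all add: sigma_closed closed)
    have "halves_section g \<cdot> \<sigma> 4 = ?L (g 1) (g 2) (g 3) \<cdot> (?R (g 6) (g 5) (g 4) \<cdot> \<sigma> 4)"
      by (simp add: halves_section_def W.m_assoc closed sigma_closed)
    also have "?R (g 6) (g 5) (g 4) \<cdot> \<sigma> 4 = ?B \<cdot> ?R (g 6) (g 4) (g 5)"
      using that by (intro W.dihedral_section_closing) (simp_all add: sigma_closed sigma_square)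
    also have "?L (g 1) (g 2) (g 3) \<cdot> (?B \<cdot> ?R (g 6) (g 4) (g 5))
        = (?L (g 1) (g 2) (g 3) \<cdot> ?B) \<cdot> ?R (g 6) (g 4) (g 5)"
      by (simp add: W.m_assoc closed)
    finally show ?thesis
      unfolding comm by (simp add: halves_section_def swap_at_apply W.m_assoc closed)
  qed
qed

lemma hexagon_loops_commute:
  "W.hexagon_loop (\<sigma> 1) (\<sigma> 2) \<cdot> W.hexagon_loop (\<sigma> 5) (\<sigma> 4)
    = W.hexagon_loop (\<sigma> 5) (\<sigma> 4) \<cdot> W.hexagon_loop (\<sigma> 1) (\<sigma> 2)"
proof -
  have "W.hexagon_loop (\<sigma> 5) (\<sigma> 4) \<cdot> \<sigma> i = \<sigma> i \<cdot> W.hexagon_loop (\<sigma> 5) (\<sigma> 4)" if "i \<in> {1, 2}" for i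
    using that by (intro W.hexagon_loop_centralizer)
      (auto simp: sigma_closed sigma_commute)
  then show ?thesis
    by (intro W.hexagon_loop_centralizer) (simp_all add: sigma_closed W.hexagon_loop_closed)
qed

lemma swap_at_braid:
  "swap_at (swap_at (swap_at g i) (i + 1)) i = swap_at (swap_at (swap_at g (i + 1)) i) (i + 1)"
proof
  fix k
  consider "k = i" | "k = i + 1" | "k = i + 1 + 1" | "k \<noteq> i" "k \<noteq> i + 1" "k \<noteq> i + 1 + 1" by blast
  then show "swap_at (swap_at (swap_at g i) (i + 1)) i k
      = swap_at (swap_at (swap_at g (i + 1)) i) (i + 1) k"
    by cases (simp_all add: swap_at_apply)
qed

text \<open>By the braid relation in the symmetric group, a full turn around a hexagon is a pure braid.\<close>

lemma perm_hexagon_loop: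
  assumes "(p, q) \<in> {(1, 2), (5, 4)}"
  shows "\<pi> (W.hexagon_loop (\<sigma> p) (\<sigma> q)) = id"
proof -
  have sigma: "\<pi> (\<sigma> i) = swap_at id i" if "i \<in> {1, 2, 3, 4, 5}" for i
    using perm_mult_sigma[of "\<one>\<^bsub>planar_braid_group 6\<^esub>" i] that
    by (simp add: planar_braid_perm_one sigma_closed)
  have braid: "swap_at (swap_at (swap_at id q) p) q = swap_at (swap_at (swap_at id p) q) p"
    using assms swap_at_braid[of id 1] swap_at_braid[of id 4] by auto
  have "\<pi> (W.hexagon_loop (\<sigma> p) (\<sigma> q))
      = swap_at (swap_at (swap_at (swap_at (swap_at (swap_at id q) p) q) p) q) p"
    using assms by (auto simp: W.hexagon_loop_def perm_mult_sigma sigma sigma_closed)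
  then show ?thesis by (simp add: braid)
qed

lemma pairs_section_swap:
  assumes g: "g permutes {1..6}" and i: "i \<in> {1, 3, 5}"
  shows "pairs_section (swap_at g i) = pairs_section g \<cdot> \<sigma> i"
proof -
  define u where "u k b = (if b then \<one>\<^bsub>planar_braid_group 6\<^esub> else \<sigma> k)" for k b
  have u: "pairs_section g = u 1 (g 1 < g 2) \<cdot> u 3 (g 3 < g 4) \<cdot> u 5 (g 5 < g 6)" for g
    by (simp add: pairs_section_def u_def)
  have closed: "u k b \<in> carrier (planar_braid_group 6)" if "k \<in> {1, 3, 5}" for k b
    using that by (auto simp: u_def sigma_closed)
  have flip: "u k (\<not> b) = u k b \<cdot> \<sigma> k" if "k \<in> {1, 3, 5}" for k b
    using that by (auto simp: u_def sigma_closed sigma_square)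
  have comm: "u l b \<cdot> \<sigma> k = \<sigma> k \<cdot> u l b" if "(k, l) \<in> {(1, 3), (1, 5), (3, 5)}" for k l b
    using that by (auto simp: u_def sigma_closed sigma_commute)
  have comm': "u l b \<cdot> (\<sigma> k \<cdot> x) = \<sigma> k \<cdot> (u l b \<cdot> x)"
    if "(k, l) \<in> {(1, 3), (1, 5), (3, 5)}" "x \<in> carrier (planar_braid_group 6)" for k l b x
  proof -
    have "u l b \<in> carrier (planar_braid_group 6)" "\<sigma> k \<in> carrier (planar_braid_group 6)"
      using that(1) by (auto intro!: closed sigma_closed)
    then have "u l b \<cdot> (\<sigma> k \<cdot> x) = (u l b \<cdot> \<sigma> k) \<cdot> x" "\<sigma> k \<cdot> (u l b \<cdot> x) = (\<sigma> k \<cdot> u l b) \<cdot> x"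
      using that(2) by (simp_all add: W.m_assoc)
    then show ?thesis using comm[OF that(1), of b] by (simp only:)
  qed
  have neg: "(y < x) = (\<not> x < y)" if "x \<noteq> y" for x y :: nat
    using that by auto
  have order: "(g 2 < g 1) = (\<not> g 1 < g 2)" "(g 4 < g 3) = (\<not> g 3 < g 4)" "(g 6 < g 5) = (\<not> g 5 < g 6)"
    by (intro neg permutes_adjacent_distinct[OF g])+
  consider "i = 1" | "i = 3" | "i = 5" using i by auto
  then show ?thesis
  proof cases
    case 1
    have "pairs_section (swap_at g 1) = u 1 (\<not> g 1 < g 2) \<cdot> u 3 (g 3 < g 4) \<cdot> u 5 (g 5 < g 6)"
      by (simp only: u order(1)[symmetric]) (simp add: swap_at_apply)
    also have "u 1 (\<not> g 1 < g 2) = u 1 (g 1 < g 2) \<cdot> \<sigma> 1" by (rule flip) simp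
    finally show ?thesis
      unfolding 1 u[of g]
      by (simp add: W.m_assoc closed sigma_closed comm comm')
  next
    case 2
    have "pairs_section (swap_at g 3) = u 1 (g 1 < g 2) \<cdot> u 3 (\<not> g 3 < g 4) \<cdot> u 5 (g 5 < g 6)"
      by (simp only: u order(2)[symmetric]) (simp add: swap_at_apply)
    also have "u 3 (\<not> g 3 < g 4) = u 3 (g 3 < g 4) \<cdot> \<sigma> 3" by (rule flip) simp
    finally show ?thesis
      unfolding 2 u[of g] by (simp add: W.m_assoc closed sigma_closed comm)
  next
    case 3
    have "pairs_section (swap_at g 5) = u 1 (g 1 < g 2) \<cdot> u 3 (g 3 < g 4) \<cdot> u 5 (\<not> g 5 < g 6)"
      by (simp only: u order(3)[symmetric]) (simp add: swap_at_apply)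
    also have "u 5 (\<not> g 5 < g 6) = u 5 (g 5 < g 6) \<cdot> \<sigma> 5" by (rule flip) simp
    finally show ?thesis
      unfolding 3 u[of g] by (simp add: W.m_assoc closed sigma_closed)
  qed
qed

lemma swap_at_eq_iff: "swap_at g i = swap_at h i \<longleftrightarrow> g = h"
proof
  assume eq: "swap_at g i = swap_at h i"
  have "swap_at (swap_at g i) i = swap_at (swap_at h i) i" by (simp only: eq)
  then show "g = h" by (simp only: swap_at_swap_at)
qed simp

text \<open>Tame swaps multiply both sides of the equation by the same transposition, and they connect the
  coset.\<close>

lemma perm_halves_section:
  assumes "r \<in> carrier (planar_braid_group 6)" "g permutes {1..6}" "h permutes {1..6}"
    and "halves g = halves h"
  shows "\<pi> (r \<cdot> halves_section g) = g \<longleftrightarrow> \<pi> (r \<cdot> halves_section h) = h"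
proof (rule halves_connected[where P = "\<lambda>g. \<pi> (r \<cdot> halves_section g) = g", OF assms(2-4)])
  fix g :: "nat \<Rightarrow> nat" and i assume g: "g permutes {1..6}" and tame: "tame_swap g i"
  then have i: "i \<in> {1, 2, 3, 4, 5}" by (auto simp: tame_swap_def)
  have "\<pi> (r \<cdot> halves_section (swap_at g i)) = swap_at (\<pi> (r \<cdot> halves_section g)) i"
    using assms(1) perm_mult_sigma[of "r \<cdot> halves_section g", OF _ i]
    by (simp add: halves_section_tame[OF g tame] halves_section_closed sigma_closed[OF i] W.m_assoc)
  then show "\<pi> (r \<cdot> halves_section g) = g \<longleftrightarrow> \<pi> (r \<cdot> halves_section (swap_at g i)) = swap_at g i"
    by (simp add: swap_at_eq_iff)
qed

lemma perm_pairs_section: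
  assumes "r \<in> carrier (planar_braid_group 6)" "g permutes {1..6}" "h permutes {1..6}"
    and "pairs g = pairs h"
  shows "\<pi> (r \<cdot> pairs_section g) = g \<longleftrightarrow> \<pi> (r \<cdot> pairs_section h) = h"
proof (rule pairs_connected[where P = "\<lambda>g. \<pi> (r \<cdot> pairs_section g) = g", OF assms(2-4)])
  fix g :: "nat \<Rightarrow> nat" and i :: nat assume g: "g permutes {1..6}" and i: "i \<in> {1, 3, 5}"
  then have i': "i \<in> {1, 2, 3, 4, 5}" by auto
  have "\<pi> (r \<cdot> pairs_section (swap_at g i)) = swap_at (\<pi> (r \<cdot> pairs_section g)) i"
    using assms(1) perm_mult_sigma[of "r \<cdot> pairs_section g", OF _ i']
    by (simp add: pairs_section_swap[OF g i] pairs_section_closed sigma_closed[OF i'] W.m_assoc)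
  then show "\<pi> (r \<cdot> pairs_section g) = g \<longleftrightarrow> \<pi> (r \<cdot> pairs_section (swap_at g i)) = swap_at g i"
    by (simp add: swap_at_eq_iff)
qed

definition halves_of_edge :: "nat set \<times> nat \<times> nat \<times> nat set \<Rightarrow> nat set \<times> nat set"
  where "halves_of_edge \<epsilon> = (case \<epsilon> of (P, x, y, Q) \<Rightarrow> (insert x P, insert y Q))"

definition pairs_of_edge :: "nat set \<times> nat \<times> nat \<times> nat set \<Rightarrow> nat set \<times> nat set \<times> nat set"
  where "pairs_of_edge \<epsilon> = (case \<epsilon> of (P, x, y, Q) \<Rightarrow> (P, {x, y}, Q))"

lemma halves_of_edge_at: "halves_of_edge (edge_at g) = halves g"
  by (auto simp: halves_of_edge_def edge_at_def halves_def)

lemma pairs_of_edge_at: "pairs_of_edge (edge_at g) = pairs g"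
  by (simp add: pairs_of_edge_def edge_at_def pairs_def)

lemma sections_agree_on_edge:
  assumes "r \<in> carrier (planar_braid_group 6)" "\<rho> \<in> carrier (planar_braid_group 6)"
    and "g permutes {1..6}" "h permutes {1..6}" "edge_at g = edge_at h"
  shows "r \<cdot> halves_section g = \<rho> \<cdot> pairs_section g \<longleftrightarrow> r \<cdot> halves_section h = \<rho> \<cdot> pairs_section h"
proof (rule edge_connected[where P = "\<lambda>g. r \<cdot> halves_section g = \<rho> \<cdot> pairs_section g", OF assms(3-5)])
  fix g :: "nat \<Rightarrow> nat" and i :: nat assume g: "g permutes {1..6}" and i: "i \<in> {1, 5}"
  then have i': "i \<in> {1, 3, 5}" "i \<in> {1, 2, 3, 4, 5}" "tame_swap g i" by (auto simp: tame_swap_def)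
  have eqs: "r \<cdot> halves_section (swap_at g i) = r \<cdot> halves_section g \<cdot> \<sigma> i"
    "\<rho> \<cdot> pairs_section (swap_at g i) = \<rho> \<cdot> pairs_section g \<cdot> \<sigma> i"
    using assms(1,2) halves_section_closed pairs_section_closed sigma_closed[OF i'(2)]
    by (simp_all add: halves_section_tame[OF g i'(3)] pairs_section_swap[OF g i'(1)] W.m_assoc)
  show "r \<cdot> halves_section g = \<rho> \<cdot> pairs_section g
      \<longleftrightarrow> r \<cdot> halves_section (swap_at g i) = \<rho> \<cdot> pairs_section (swap_at g i)"
    unfolding eqs
    by (simp add: assms(1,2) halves_section_closed pairs_section_closed sigma_closed[OF i'(2)])
qed

section \<open>The quotient graph and its lifts\<close>

abbreviation "S6 \<equiv> {g. g permutes {1..6::nat}}"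

text \<open>Connectedness of the subgraph with edge set \<open>T\<close>, as a principle of propagation: \<open>P\<close>
  and \<open>Q\<close> are properties of the two kinds of vertices that are carried along edges in
  \<open>T\<close> in both directions, and \<open>P\<close> holds at the coset of the identity.\<close>

definition connects :: "(nat set \<times> nat \<times> nat \<times> nat set) set \<Rightarrow> bool"
  where "connects T \<longleftrightarrow> (\<forall>P Q. P (halves id) \<longrightarrow>
    (\<forall>g. g permutes {1..6} \<longrightarrow> edge_at g \<in> T \<longrightarrow> P (halves g) = Q (pairs g)) \<longrightarrow>
    (\<forall>g. g permutes {1..6} \<longrightarrow> P (halves g) \<and> Q (pairs g)))"

text \<open>Every swap stays within a coset of one of the two kinds, and the two cosets of an arrangement
  are joined by an edge; the swaps reach all arrangements.\<close>

lemma orbit_graph_connected: "connects (edge_at ` S6)"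
  unfolding connects_def
proof (intro allI impI)
  fix P :: "nat set \<times> nat set \<Rightarrow> bool" and Q and g :: "nat \<Rightarrow> nat"
  assume base: "P (halves id)" and g: "g permutes {1..6}"
    and "\<forall>g. g permutes {1..6} \<longrightarrow> edge_at g \<in> edge_at ` S6 \<longrightarrow> P (halves g) = Q (pairs g)"
  then have edge: "P (halves g) = Q (pairs g)" if "g permutes {1..6}" for g
    using that by blast
  show "P (halves g) \<and> Q (pairs g)"
    using g
  proof (induction g rule: permutes_adjacent_induct)
    case id
    then show ?case using base edge[of id] permutes_id by blast
  next
    case (swap g i)
    have perm: "swap_at g i permutes {1..6}" using swap by (intro swap_at_permutes)
    show ?case
    proof (cases "i = 3")
      case True
      then have "Q (pairs (swap_at g i))" using swap pairs_swap_at[of i g] by simp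
      then show ?thesis using edge[OF perm] by blast
    next
      case False
      then have "i \<in> {1, 2, 4, 5}" using swap by auto
      then have "P (halves (swap_at g i))" using swap halves_swap_at[of i g] by simp
      then show ?thesis using edge[OF perm] by blast
    qed
  qed
qed

lemma halves_section_id: "halves_section id = \<one>\<^bsub>planar_braid_group 6\<^esub>"
  by (simp add: halves_section_def W.dihedral_section_def)

text \<open>Lifts \<open>r\<close> and \<open>\<rho>\<close> of the sorted arrangements of the cosets to braids, which extend by
  the sections to lifts of all arrangements. Along a spanning tree the two lifts of an arrangement can
  be made to agree: dividing one lift by the other section gives the value required at the other end
  of an edge, and on an edge it is the same for all of its arrangements because both sections are
  compatible with the swaps at positions 1 and 5.\<close>

lemma compatible_lifts:
  obtains T r \<rho> where "T \<subseteq> edge_at ` S6" "card T = 109"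
    "connects T"
    "r (halves id) = \<one>\<^bsub>planar_braid_group 6\<^esub>"
    "\<And>g. g permutes {1..6} \<Longrightarrow> r (halves g) \<in> carrier (planar_braid_group 6)
      \<and> \<pi> (r (halves g) \<cdot> halves_section g) = g"
    "\<And>g. g permutes {1..6} \<Longrightarrow> \<rho> (pairs g) \<in> carrier (planar_braid_group 6)
      \<and> \<pi> (\<rho> (pairs g) \<cdot> pairs_section g) = g"
    "\<And>g. g permutes {1..6} \<Longrightarrow> edge_at g \<in> T \<Longrightarrow>
      r (halves g) \<cdot> halves_section g = \<rho> (pairs g) \<cdot> pairs_section g"
proof -
  define V :: "(nat set \<times> nat set + nat set \<times> nat set \<times> nat set) set"
    where "V = halves ` S6 <+> pairs ` S6"
  define L where "L v = {x \<in> carrier (planar_braid_group 6). \<forall>g. g permutes {1..6} \<longrightarrow>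
      (case v of Inl h \<Rightarrow> halves g = h \<longrightarrow> \<pi> (x \<cdot> halves_section g) = g
        | Inr p \<Rightarrow> pairs g = p \<longrightarrow> \<pi> (x \<cdot> pairs_section g) = g)}"
    for v :: "nat set \<times> nat set + nat set \<times> nat set \<times> nat set"
  define M where "M \<epsilon> x y \<longleftrightarrow> (\<forall>g. g permutes {1..6} \<longrightarrow> edge_at g = \<epsilon> \<longrightarrow>
      x \<cdot> halves_section g = y \<cdot> pairs_section g)" for \<epsilon> x y
  have L_Inl: "x \<in> L (Inl (halves g)) \<longleftrightarrow>
      x \<in> carrier (planar_braid_group 6) \<and> \<pi> (x \<cdot> halves_section g) = g"
    if g: "g permutes {1..6}" for x g
  proof
    assume "x \<in> carrier (planar_braid_group 6) \<and> \<pi> (x \<cdot> halves_section g) = g"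
    then have "\<pi> (x \<cdot> halves_section h) = h" if "h permutes {1..6}" "halves h = halves g" for h
      using perm_halves_section[OF _ that(1) g that(2)] by simp
    then show "x \<in> L (Inl (halves g))"
      using \<open>x \<in> _ \<and> _\<close> unfolding L_def by simp
  qed (use g in \<open>simp add: L_def\<close>)
  have L_Inr: "x \<in> L (Inr (pairs g)) \<longleftrightarrow>
      x \<in> carrier (planar_braid_group 6) \<and> \<pi> (x \<cdot> pairs_section g) = g"
    if g: "g permutes {1..6}" for x g
  proof
    assume "x \<in> carrier (planar_braid_group 6) \<and> \<pi> (x \<cdot> pairs_section g) = g"
    then have "\<pi> (x \<cdot> pairs_section h) = h" if "h permutes {1..6}" "pairs h = pairs g" for h
      using perm_pairs_section[OF _ that(1) g that(2)] by simp
    then show "x \<in> L (Inr (pairs g))"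
      using \<open>x \<in> _ \<and> _\<close> unfolding L_def by simp
  qed (use g in \<open>simp add: L_def\<close>)
  have M_iff: "M (edge_at g) x y \<longleftrightarrow> x \<cdot> halves_section g = y \<cdot> pairs_section g"
    if g: "g permutes {1..6}"
      and xy: "x \<in> carrier (planar_braid_group 6)" "y \<in> carrier (planar_braid_group 6)" for g x y
  proof
    assume "x \<cdot> halves_section g = y \<cdot> pairs_section g"
    then have "x \<cdot> halves_section h = y \<cdot> pairs_section h"
      if "h permutes {1..6}" "edge_at h = edge_at g" for h
      using sections_agree_on_edge[OF xy g that(1)] that(2) by simp
    then show "M (edge_at g) x y" unfolding M_def by blast
  qed (use g in \<open>simp add: M_def\<close>)
  have "finite S6" by (simp add: finite_permutations)
  then have "finite V" unfolding V_def by simp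
  moreover have "Inl (halves id) \<in> V" unfolding V_def using permutes_id by blast
  moreover have "\<one>\<^bsub>planar_braid_group 6\<^esub> \<in> L (Inl (halves id))"
    by (subst L_Inl) (simp_all add: permutes_id halves_section_id planar_braid_perm_one)
  moreover have "Inl (halves_of_edge \<epsilon>) \<in> V \<and> Inr (pairs_of_edge \<epsilon>) \<in> V" if "\<epsilon> \<in> edge_at ` S6" for \<epsilon>
    using that unfolding V_def by (auto simp: halves_of_edge_at pairs_of_edge_at)
  moreover have "V \<subseteq> X"
    if base: "Inl (halves id) \<in> X"
      and closed: "\<And>\<epsilon>. \<epsilon> \<in> edge_at ` S6 \<Longrightarrow> Inl (halves_of_edge \<epsilon>) \<in> X \<longleftrightarrow> Inr (pairs_of_edge \<epsilon>) \<in> X" for X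
  proof -
    have "Inl (halves g) \<in> X \<longleftrightarrow> Inr (pairs g) \<in> X" if "g permutes {1..6}" for g
      using closed[of "edge_at g"] that
      by (simp add: halves_of_edge_at pairs_of_edge_at)
    then have "Inl (halves g) \<in> X \<and> Inr (pairs g) \<in> X" if "g permutes {1..6}" for g
      using orbit_graph_connected[unfolded connects_def, rule_format,
        of "\<lambda>v. Inl v \<in> X" "\<lambda>w. Inr w \<in> X"] base that by blast
    then show ?thesis unfolding V_def by auto
  qed
  moreover have "\<exists>y\<in>L (Inr (pairs_of_edge \<epsilon>)). M \<epsilon> x y"
    if "\<epsilon> \<in> edge_at ` S6" "x \<in> L (Inl (halves_of_edge \<epsilon>))" for \<epsilon> x
  proof -
    obtain g where g: "g permutes {1..6}" "\<epsilon> = edge_at g" using \<open>\<epsilon> \<in> edge_at ` S6\<close> by blast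
    have x: "x \<in> carrier (planar_braid_group 6)" "\<pi> (x \<cdot> halves_section g) = g"
      using that(2) L_Inl[OF g(1)] by (simp_all add: g(2) halves_of_edge_at)
    let ?y = "x \<cdot> halves_section g \<cdot> inv\<^bsub>planar_braid_group 6\<^esub> (pairs_section g)"
    have y: "?y \<in> carrier (planar_braid_group 6)" "?y \<cdot> pairs_section g = x \<cdot> halves_section g"
      using x(1) by (simp_all add: halves_section_closed pairs_section_closed W.m_assoc)
    then have "?y \<in> L (Inr (pairs g))" "M (edge_at g) x ?y"
      using x by (simp_all add: L_Inr[OF g(1)] M_iff[OF g(1)])
    then show ?thesis unfolding g(2) pairs_of_edge_at by blast
  qed
  moreover have "\<exists>x\<in>L (Inl (halves_of_edge \<epsilon>)). M \<epsilon> x y"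
    if "\<epsilon> \<in> edge_at ` S6" "y \<in> L (Inr (pairs_of_edge \<epsilon>))" for \<epsilon> y
  proof -
    obtain g where g: "g permutes {1..6}" "\<epsilon> = edge_at g" using \<open>\<epsilon> \<in> edge_at ` S6\<close> by blast
    have y: "y \<in> carrier (planar_braid_group 6)" "\<pi> (y \<cdot> pairs_section g) = g"
      using that(2) L_Inr[OF g(1)] by (simp_all add: g(2) pairs_of_edge_at)
    let ?x = "y \<cdot> pairs_section g \<cdot> inv\<^bsub>planar_braid_group 6\<^esub> (halves_section g)"
    have x: "?x \<in> carrier (planar_braid_group 6)" "?x \<cdot> halves_section g = y \<cdot> pairs_section g"
      using y(1) by (simp_all add: halves_section_closed pairs_section_closed W.m_assoc)
    then have "?x \<in> L (Inl (halves g))" "M (edge_at g) ?x y"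
      using y by (simp_all add: L_Inl[OF g(1)] M_iff[OF g(1)])
    then show ?thesis unfolding g(2) halves_of_edge_at by blast
  qed
  ultimately obtain T l where T: "T \<subseteq> edge_at ` S6" "card T + 1 = card V"
    and conn: "\<And>X. Inl (halves id) \<in> X \<Longrightarrow>
      (\<And>\<epsilon>. \<epsilon> \<in> T \<Longrightarrow> Inl (halves_of_edge \<epsilon>) \<in> X \<longleftrightarrow> Inr (pairs_of_edge \<epsilon>) \<in> X) \<Longrightarrow> V \<subseteq> X"
    and l: "l (Inl (halves id)) = \<one>\<^bsub>planar_braid_group 6\<^esub>" "\<And>v. v \<in> V \<Longrightarrow> l v \<in> L v"
      "\<And>\<epsilon>. \<epsilon> \<in> T \<Longrightarrow> M \<epsilon> (l (Inl (halves_of_edge \<epsilon>))) (l (Inr (pairs_of_edge \<epsilon>)))"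
    by (rule spanning_tree_with_lifts[where s = "\<lambda>\<epsilon>. Inl (halves_of_edge \<epsilon>)"
      and t = "\<lambda>\<epsilon>. Inr (pairs_of_edge \<epsilon>)"]) (assumption | blast)+
  have "card V = 20 + 90"
    unfolding V_def using \<open>finite S6\<close> card_halves card_pairs by (simp add: card_Plus)
  with T have card_T: "card T = 109" by simp
  have V_mem: "Inl (halves g) \<in> V" "Inr (pairs g) \<in> V" if "g permutes {1..6}" for g
    using that unfolding V_def by auto
  have r: "l (Inl (halves g)) \<in> carrier (planar_braid_group 6)
      \<and> \<pi> (l (Inl (halves g)) \<cdot> halves_section g) = g" if "g permutes {1..6}" for g
    using l(2)[OF V_mem(1)[OF that]] L_Inl[OF that] by simp
  have \<rho>: "l (Inr (pairs g)) \<in> carrier (planar_braid_group 6)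
      \<and> \<pi> (l (Inr (pairs g)) \<cdot> pairs_section g) = g" if "g permutes {1..6}" for g
    using l(2)[OF V_mem(2)[OF that]] L_Inr[OF that] by simp
  show thesis
  proof (rule that[of T "\<lambda>h. l (Inl h)" "\<lambda>p. l (Inr p)"])
    show "connects T"
      unfolding connects_def
    proof (intro allI impI)
      fix P :: "nat set \<times> nat set \<Rightarrow> bool" and Q and g :: "nat \<Rightarrow> nat"
      assume base: "P (halves id)" and g: "g permutes {1..6}"
        and edge: "\<forall>g. g permutes {1..6} \<longrightarrow> edge_at g \<in> T \<longrightarrow> P (halves g) = Q (pairs g)"
      have "V \<subseteq> Collect (case_sum P Q)"
      proof (rule conn)
        fix \<epsilon> assume "\<epsilon> \<in> T"
        then obtain h where "h permutes {1..6}" "\<epsilon> = edge_at h" using T(1) by blast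
        then show "Inl (halves_of_edge \<epsilon>) \<in> Collect (case_sum P Q)
            \<longleftrightarrow> Inr (pairs_of_edge \<epsilon>) \<in> Collect (case_sum P Q)"
          using edge \<open>\<epsilon> \<in> T\<close> by (simp add: halves_of_edge_at pairs_of_edge_at)
      qed (simp add: base)
      then show "P (halves g) \<and> Q (pairs g)"
        using subsetD[OF _ V_mem(1)[OF g]] subsetD[OF _ V_mem(2)[OF g]] by force
    qed
  next
    fix g :: "nat \<Rightarrow> nat" assume g: "g permutes {1..6}" "edge_at g \<in> T"
    then show "l (Inl (halves g)) \<cdot> halves_section g = l (Inr (pairs g)) \<cdot> pairs_section g"
      using l(3)[OF g(2)] r[OF g(1)] \<rho>[OF g(1)] M_iff[OF g(1)]
      by (simp add: halves_of_edge_at pairs_of_edge_at)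
  qed (use T(1) card_T l(1) r \<rho> in simp_all)
qed

text \<open>Each hexagon is opened somewhere: the patterns 3, 1, 2 on the left and 2, 3, 1 on the right
  are reached from the sorted arrangement.\<close>

lemma closing_arrangement_exists:
  assumes "g permutes {1..6}"
  shows "\<exists>h. h permutes {1..6} \<and> halves h = halves g \<and> h 2 < h 3 \<and> h 3 < h 1"
    and "\<exists>h. h permutes {1..6} \<and> halves h = halves g \<and> h 6 < h 4 \<and> h 4 < h 5"
proof -
  have "\<exists>s. s permutes {1..6} \<and> halves s = halves g \<and> (\<forall>i\<in>{1, 2, 4, 5}. s i < s (i + 1))"
  proof (rule sort_by_adjacent_swaps[of g "\<lambda>s. halves s = halves g" "{1, 2, 4, 5}"])
    fix s :: "nat \<Rightarrow> nat"
    assume s: "halves s = halves g" "\<exists>i\<in>{1, 2, 4, 5}. s (i + 1) < s i"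
    then obtain i where i: "i \<in> {1, 2, 4, 5}" "s (i + 1) < s i" by blast
    have "halves (swap_at s i) = halves g" using halves_swap_at[OF i(1), of s] s(1) by simp
    then show "\<exists>i\<in>{1, 2, 4, 5}. s (i + 1) < s i \<and> halves (swap_at s i) = halves g"
      using i by blast
  qed (use assms in auto)
  then obtain s where s: "s permutes {1..6}" "halves s = halves g"
    and "\<forall>i\<in>{1, 2, 4, 5}. s i < s (i + 1)" by blast
  then have less: "s 1 < s 2" "s 2 < s 3" "s 4 < s 5" "s 5 < s 6" by simp_all
  have perm: "swap_at (swap_at s 2) 1 permutes {1..6}" "swap_at (swap_at s 4) 5 permutes {1..6}"
    using s(1) by (simp_all add: swap_at_permutes)
  have half: "halves (swap_at (swap_at s 2) 1) = halves g" "halves (swap_at (swap_at s 4) 5) = halves g"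
    using s(2) by (simp_all add: halves_swap_at)
  show "\<exists>h. h permutes {1..6} \<and> halves h = halves g \<and> h 2 < h 3 \<and> h 3 < h 1"
    using perm(1) half(1) less by (intro exI[of _ "swap_at (swap_at s 2) 1"]) (simp add: swap_at_apply)
  show "\<exists>h. h permutes {1..6} \<and> halves h = halves g \<and> h 6 < h 4 \<and> h 4 < h 5"
    using perm(2) half(2) less by (intro exI[of _ "swap_at (swap_at s 4) 5"]) (simp add: swap_at_apply)
qed

section \<open>Pure braids and the group of weights\<close>

text \<open>The data that determine the isomorphism. The map \<open>\<psi>\<close> sends the elements of
  \<open>F\<close> that label edges and hexagons to the pure braids that measure the incompatibility of the
  lifts there. The last assumption says that these labels determine the endomorphisms of
  \<open>F\<close>; together with the existence of \<open>\<psi>\<close> it stands for the universal property of the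
  free product.\<close>

locale pure_braid_splitting = graph_of_groups_weights F e a b
  for F (structure) and e :: "(nat \<Rightarrow> nat) \<Rightarrow> 'a" and a b +
  fixes T :: "(nat set \<times> nat \<times> nat \<times> nat set) set"
    and r :: "nat set \<times> nat set \<Rightarrow> (nat \<times> bool) list set"
    and \<rho> :: "nat set \<times> nat set \<times> nat set \<Rightarrow> (nat \<times> bool) list set"
    and \<psi> :: "'a \<Rightarrow> (nat \<times> bool) list set"
  assumes tree: "connects T"
    and r_base: "r (halves id) = \<one>\<^bsub>planar_braid_group 6\<^esub>"
    and r_lift: "g permutes {1..6} \<Longrightarrow> r (halves g) \<in> carrier (planar_braid_group 6)
      \<and> \<pi> (r (halves g) \<cdot> halves_section g) = g"
    and \<rho>_lift: "g permutes {1..6} \<Longrightarrow> \<rho> (pairs g) \<in> carrier (planar_braid_group 6)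
      \<and> \<pi> (\<rho> (pairs g) \<cdot> pairs_section g) = g"
    and agree: "g permutes {1..6} \<Longrightarrow> edge_at g \<in> T \<Longrightarrow>
      r (halves g) \<cdot> halves_section g = \<rho> (pairs g) \<cdot> pairs_section g"
    and e_tree: "g permutes {1..6} \<Longrightarrow> edge_at g \<in> T \<Longrightarrow> e g = \<one>"
    and psi_hom: "\<psi> \<in> hom F (planar_braid_group 6)"
    and psi_e: "g permutes {1..6} \<Longrightarrow>
      \<psi> (e g) \<cdot> (r (halves g) \<cdot> halves_section g) = \<rho> (pairs g) \<cdot> pairs_section g"
    and psi_a: "g permutes {1..6} \<Longrightarrow>
      \<psi> (a (halves g)) \<cdot> r (halves g) = r (halves g) \<cdot> W.hexagon_loop (\<sigma> 1) (\<sigma> 2)"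
    and psi_b: "g permutes {1..6} \<Longrightarrow>
      \<psi> (b (halves g)) \<cdot> r (halves g) = r (halves g) \<cdot> W.hexagon_loop (\<sigma> 5) (\<sigma> 4)"
    and perm_psi: "y \<in> carrier F \<Longrightarrow> \<pi> (\<psi> y) = id"
    and generated: "f \<in> hom F F \<Longrightarrow> (\<And>g. g permutes {1..6} \<Longrightarrow>
      f (e g) = e g \<and> f (a (halves g)) = a (halves g) \<and> f (b (halves g)) = b (halves g)) \<Longrightarrow>
      y \<in> carrier F \<Longrightarrow> f y = y"
begin

interpretation psi: group_hom F "planar_braid_group 6" \<psi>
  by unfold_locales (rule psi_hom)

text \<open>The lifts of all arrangements determined by the two kinds of cosets.\<close>

definition t :: "(nat \<Rightarrow> nat) \<Rightarrow> (nat \<times> bool) list set"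
  where "t g = r (halves g) \<cdot> halves_section g"

definition q :: "(nat \<Rightarrow> nat) \<Rightarrow> (nat \<times> bool) list set"
  where "q g = \<rho> (pairs g) \<cdot> pairs_section g"

lemma t_closed: "g permutes {1..6} \<Longrightarrow> t g \<in> carrier (planar_braid_group 6)"
  using r_lift by (simp add: t_def halves_section_closed)

lemma q_closed: "g permutes {1..6} \<Longrightarrow> q g \<in> carrier (planar_braid_group 6)"
  using \<rho>_lift by (simp add: q_def pairs_section_closed)

lemma perm_t: "g permutes {1..6} \<Longrightarrow> \<pi> (t g) = g"
  using r_lift by (simp add: t_def)

lemma perm_q: "g permutes {1..6} \<Longrightarrow> \<pi> (q g) = g"
  using \<rho>_lift by (simp add: q_def)

lemma t_id: "t id = \<one>\<^bsub>planar_braid_group 6\<^esub>"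
  by (simp add: t_def r_base halves_section_id)

lemma t_tame:
  assumes g: "g permutes {1..6}" and tame: "tame_swap g i"
  shows "t (swap_at g i) = t g \<cdot> \<sigma> i"
proof -
  have i: "i \<in> {1, 2, 4, 5}" "i \<in> {1, 2, 3, 4, 5}" using tame by (auto simp: tame_swap_def)
  show ?thesis
    using r_lift[OF g]
    by (simp add: t_def halves_swap_at[OF i(1)] halves_section_tame[OF g tame] W.m_assoc
      halves_section_closed sigma_closed[OF i(2)])
qed

lemma q_swap:
  assumes g: "g permutes {1..6}" and i: "i \<in> {1, 3, 5}"
  shows "q (swap_at g i) = q g \<cdot> \<sigma> i"
proof -
  have "i \<in> {1, 2, 3, 4, 5}" using i by auto
  then show ?thesis
    using \<rho>_lift[OF g]
    by (simp add: q_def pairs_swap_at[OF i] pairs_section_swap[OF g i] W.m_assoc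
      pairs_section_closed sigma_closed)
qed

lemma psi_e_t: "g permutes {1..6} \<Longrightarrow> \<psi> (e g) \<cdot> t g = q g"
  using psi_e by (simp add: t_def q_def)

lemma t_closing:
  assumes g: "g permutes {1..6}"
  shows "g 2 < g 3 \<Longrightarrow> g 3 < g 1 \<Longrightarrow> t g \<cdot> \<sigma> 2 = \<psi> (a (halves g)) \<cdot> t (swap_at g 2)"
    and "g 6 < g 4 \<Longrightarrow> g 4 < g 5 \<Longrightarrow> t g \<cdot> \<sigma> 4 = \<psi> (b (halves g)) \<cdot> t (swap_at g 4)"
proof -
  have ab: "\<psi> (a (halves g)) \<in> carrier (planar_braid_group 6)" "\<psi> (b (halves g)) \<in> carrier (planar_braid_group 6)"
    using ab_closed[of "halves g"] g by (simp_all add: psi.hom_closed)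
  have r: "r (halves g) \<in> carrier (planar_braid_group 6)" using r_lift[OF g] by simp
  have loop: "W.hexagon_loop (\<sigma> 1) (\<sigma> 2) \<in> carrier (planar_braid_group 6)"
    "W.hexagon_loop (\<sigma> 5) (\<sigma> 4) \<in> carrier (planar_braid_group 6)"
    by (simp_all add: W.hexagon_loop_closed sigma_closed)
  have *: "t g \<cdot> \<sigma> i = x \<cdot> t (swap_at g i)"
    if i: "i \<in> {1, 2, 4, 5}" and x: "x \<in> carrier (planar_braid_group 6)" "l \<in> carrier (planar_braid_group 6)"
      "x \<cdot> r (halves g) = r (halves g) \<cdot> l"
      and lifts: "halves_section g \<cdot> \<sigma> i = l \<cdot> halves_section (swap_at g i)" for i x l
  proof -
    have i': "i \<in> {1, 2, 3, 4, 5}" using i by auto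
    have "t g \<cdot> \<sigma> i = r (halves g) \<cdot> (halves_section g \<cdot> \<sigma> i)"
      using r by (simp add: t_def W.m_assoc halves_section_closed sigma_closed[OF i'])
    also have "\<dots> = (r (halves g) \<cdot> l) \<cdot> halves_section (swap_at g i)"
      unfolding lifts using r x(2) by (simp add: W.m_assoc halves_section_closed)
    also have "\<dots> = x \<cdot> t (swap_at g i)"
      unfolding x(3)[symmetric] using r x(1)
      by (simp add: t_def halves_swap_at[OF i] W.m_assoc halves_section_closed)
    finally show ?thesis .
  qed
  show "t g \<cdot> \<sigma> 2 = \<psi> (a (halves g)) \<cdot> t (swap_at g 2)" if "g 2 < g 3" "g 3 < g 1"
    using halves_section_closing(1)[OF that] psi_a[OF g] by (intro *[OF _ ab(1) loop(1)]) simp_all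
  show "t g \<cdot> \<sigma> 4 = \<psi> (b (halves g)) \<cdot> t (swap_at g 4)" if "g 6 < g 4" "g 4 < g 5"
    using halves_section_closing(2)[OF that] psi_b[OF g] by (intro *[OF _ ab(2) loop(2)]) simp_all
qed

text \<open>The key identity: under \<open>\<psi>\<close> the weight of an edge of the Cayley graph becomes the
  loop that follows the lift to the start of the edge, crosses the edge and returns along the lift of
  its end. For swaps at position 3 this passes through the lift \<open>q\<close>, which is compatible with
  such swaps.\<close>

lemma psi_weight:
  assumes g: "g permutes {1..6}" and i: "i \<in> {1..<6}"
  shows "\<psi> (weight g i) \<cdot> t (swap_at g i) = t g \<cdot> \<sigma> i"
proof -
  have perm: "swap_at g i permutes {1..6}" using g i by (rule swap_at_permutes)
  have i': "i \<in> {1, 2, 3, 4, 5}" using i by auto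
  have ab: "a (halves g) \<in> carrier F" "b (halves g) \<in> carrier F"
    using ab_closed[of "halves g"] g by simp_all
  note distinct = permutes_adjacent_distinct[OF g]
  have reverse: "\<psi> (inv x) \<cdot> t (swap_at g i) = t g \<cdot> \<sigma> i"
    if x: "x \<in> carrier F" and "t (swap_at g i) \<cdot> \<sigma> i = \<psi> x \<cdot> t g" for x
  proof -
    have "\<psi> (inv x) \<cdot> t (swap_at g i) = \<psi> (inv x) \<cdot> (t (swap_at g i) \<cdot> \<sigma> i) \<cdot> \<sigma> i"
      using x t_closed[OF perm]
      by (simp add: W.m_assoc sigma_closed[OF i'] sigma_square[OF i'] psi.hom_closed)
    also have "\<dots> = t g \<cdot> \<sigma> i"
      unfolding that(2) using x t_closed[OF g]
      by (simp add: W.m_assoc[symmetric] sigma_closed[OF i'] psi.hom_closed psi.hom_inv)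
    finally show ?thesis .
  qed
  consider (tame) "tame_swap g i" | (e) "i = 3"
    | (a) "i = 2" "g 2 < g 3" "g 3 < g 1" | (a') "i = 2" "g 3 < g 2" "g 2 < g 1"
    | (b) "i = 4" "g 6 < g 4" "g 4 < g 5" | (b') "i = 4" "g 6 < g 5" "g 5 < g 4"
  proof (cases "tame_swap g i \<or> i = 3")
    case False
    then have "i = 2 \<and> g 2 < g 1 \<and> g 3 < g 1 \<or> i = 4 \<and> g 6 < g 5 \<and> g 6 < g 4"
      using i' by (auto simp: tame_swap_def)
    then show ?thesis
      using that(3-6) distinct(3,5) by (metis linorder_neqE_nat)
  qed (use that in blast)
  then show ?thesis
  proof cases
    case tame
    then show ?thesis
      using t_closed[OF g] by (simp add: weight_tame psi.hom_one t_tame[OF g] sigma_closed[OF i'])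
  next
    case e
    have perm3: "swap_at g 3 permutes {1..6}" using perm e by simp
    have "\<psi> (weight g 3) \<cdot> t (swap_at g 3) = \<psi> (inv (e g)) \<cdot> (\<psi> (e (swap_at g 3)) \<cdot> t (swap_at g 3))"
      using e_closed[OF g] e_closed[OF perm3] t_closed[OF perm3]
      by (simp add: weight_def psi.hom_mult psi.hom_closed W.m_assoc)
    also have "\<dots> = \<psi> (inv (e g)) \<cdot> (q g \<cdot> \<sigma> 3)"
      by (simp add: psi_e_t[OF perm3] q_swap[OF g])
    also have "\<dots> = \<psi> (inv (e g)) \<cdot> (\<psi> (e g) \<cdot> t g \<cdot> \<sigma> 3)"
      by (simp add: psi_e_t[OF g])
    also have "\<dots> = t g \<cdot> \<sigma> 3"
      using e_closed[OF g] t_closed[OF g]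
      by (simp add: W.m_assoc[symmetric] psi.hom_inv psi.hom_closed sigma_closed)
    finally show ?thesis using e by simp
  next
    case a
    then have "weight g i = a (halves g)" by (simp add: weight_def hexagon_weight_def)
    then show ?thesis using t_closing(1)[OF g] a by simp
  next
    case a'
    then have "weight g i = inv (a (halves g))" by (simp add: weight_def hexagon_weight_def)
    moreover have "t (swap_at g i) \<cdot> \<sigma> i = \<psi> (a (halves g)) \<cdot> t g"
      using t_closing(1)[OF perm] a' by (simp add: swap_at_apply halves_swap_at)
    ultimately show ?thesis using reverse[OF ab(1)] by simp
  next
    case b
    then have "weight g i = b (halves g)" by (simp add: weight_def hexagon_weight_def)
    then show ?thesis using t_closing(2)[OF g] b by simp
  next
    case b'
    then have "weight g i = inv (b (halves g))" by (simp add: weight_def hexagon_weight_def)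
    moreover have "t (swap_at g i) \<cdot> \<sigma> i = \<psi> (b (halves g)) \<cdot> t g"
      using t_closing(2)[OF perm] b' by (simp add: swap_at_apply halves_swap_at)
    ultimately show ?thesis using reverse[OF ab(2)] by simp
  qed
qed

text \<open>The identity of \<open>psi_weight\<close>, multiplied along a path; the intermediate lifts cancel.\<close>

lemma psi_transport:
  assumes "U \<in> carrier (planar_braid_group 6)" and g: "g permutes {1..6}"
  shows "\<psi> (transport g U) \<cdot> t (g \<circ> \<pi> U) = t g \<cdot> U"
  using assms(1)
proof (induction U rule: braid_group_induct)
  case one
  then show ?case
    using t_closed[OF g] by (simp add: transport_one[OF g] psi.hom_one planar_braid_perm_one)
next
  case (mult U i)
  let ?h = "g \<circ> \<pi> U"
  have h: "?h permutes {1..6}"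
    using planar_braid_perm_permutes[OF mult.hyps(1)] g by (rule permutes_compose)
  have perm: "g \<circ> \<pi> (U \<cdot> \<sigma> i) = swap_at ?h i"
    using planar_braid_perm_mult_generator[OF mult.hyps] by (simp add: swap_at_def o_assoc)
  have closed: "\<psi> (transport g U) \<in> carrier (planar_braid_group 6)"
    "\<psi> (weight ?h i) \<in> carrier (planar_braid_group 6)" "t (swap_at ?h i) \<in> carrier (planar_braid_group 6)"
    "t ?h \<in> carrier (planar_braid_group 6)" "\<sigma> i \<in> carrier (planar_braid_group 6)"
    using transport_closed[OF mult.hyps(1) g] c_closed[OF h mult.hyps(2)]
      swap_at_permutes[OF h mult.hyps(2)] h mult.hyps(2)
    by (simp_all add: psi.hom_closed t_closed braid_generator_closed del: atLeastLessThan_iff)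
  have "\<psi> (transport g (U \<cdot> \<sigma> i)) \<cdot> t (g \<circ> \<pi> (U \<cdot> \<sigma> i))
      = \<psi> (transport g U) \<cdot> (\<psi> (weight ?h i) \<cdot> t (swap_at ?h i))"
    unfolding perm transport_mult_generator[OF mult.hyps g]
    using closed transport_closed[OF mult.hyps(1) g] c_closed[OF h mult.hyps(2)]
    by (simp add: psi.hom_mult W.m_assoc)
  also have "\<dots> = \<psi> (transport g U) \<cdot> t ?h \<cdot> \<sigma> i"
    unfolding psi_weight[OF h mult.hyps(2)] using closed by (simp add: W.m_assoc)
  also have "\<dots> = t g \<cdot> (U \<cdot> \<sigma> i)"
    unfolding mult.IH using closed t_closed[OF g] mult.hyps(1) by (simp add: W.m_assoc)
  finally show ?case .
qed

text \<open>The lifts are themselves paths of known weight. Both claims are unchanged by moving inside a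
  coset, because tame swaps are free and the weights of the swaps in the other cosets telescope. They
  are equivalent on an edge of the spanning tree, where the two lifts agree and the label is trivial.
  Hence they spread over the whole graph from the identity, whose lift is the trivial braid.\<close>

lemma transport_t_q:
  assumes "g permutes {1..6}"
  shows "transport id (t g) = \<one> \<and> transport id (q g) = e g"
proof -
  define P where "P h \<longleftrightarrow> (\<forall>g. g permutes {1..6} \<longrightarrow> halves g = h \<longrightarrow> transport id (t g) = \<one>)" for h
  define Q where "Q p \<longleftrightarrow> (\<forall>g. g permutes {1..6} \<longrightarrow> pairs g = p \<longrightarrow> transport id (q g) = e g)" for p
  have step: "transport id (x \<cdot> \<sigma> i) = transport id x \<otimes> weight (\<pi> x) i"
    if "x \<in> carrier (planar_braid_group 6)" "i \<in> {1..<6}" for x i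
    using transport_mult_generator[OF that permutes_id] by simp
  have P: "P (halves g) \<longleftrightarrow> transport id (t g) = \<one>" if g: "g permutes {1..6}" for g
  proof -
    have "transport id (t g) = \<one> \<longleftrightarrow> transport id (t h) = \<one>"
      if h: "h permutes {1..6}" "halves g = halves h" for h
    proof (rule halves_connected[where P = "\<lambda>g. transport id (t g) = \<one>", OF g h])
      fix k :: "nat \<Rightarrow> nat" and i assume k: "k permutes {1..6}" and tame: "tame_swap k i"
      have i: "i \<in> {1..<6}" using tame by (auto simp: tame_swap_def)
      show "transport id (t k) = \<one> \<longleftrightarrow> transport id (t (swap_at k i)) = \<one>"
        using transport_closed[OF t_closed[OF k] permutes_id]
        by (simp only: t_tame[OF k tame] step[OF t_closed[OF k] i] perm_t[OF k] weight_tame[OF tame] r_one)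
    qed
    then show ?thesis using g unfolding P_def by metis
  qed
  have Q: "Q (pairs g) \<longleftrightarrow> transport id (q g) = e g" if g: "g permutes {1..6}" for g
  proof -
    have "transport id (q g) = e g \<longleftrightarrow> transport id (q h) = e h"
      if h: "h permutes {1..6}" "pairs g = pairs h" for h
    proof (rule pairs_connected[where P = "\<lambda>g. transport id (q g) = e g", OF g h])
      fix k :: "nat \<Rightarrow> nat" and i :: nat assume k: "k permutes {1..6}" and i: "i \<in> {1, 3, 5}"
      have i': "i \<in> {1..<6}" using i by auto
      have k': "swap_at k i permutes {1..6}" using k i' by (rule swap_at_permutes)
      have x: "transport id (q k) \<in> carrier F"
        by (rule transport_closed[OF q_closed[OF k] permutes_id])
      have weight: "weight k i = inv (e k) \<otimes> e (swap_at k i)"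
      proof (cases "i = 3")
        case False
        then have "i \<in> {1, 5}" using i by auto
        then show ?thesis
          using e_swap[OF k] e_closed[OF k] weight_tame[of k i] by (auto simp: tame_swap_def)
      qed (simp add: weight_def)
      have "transport id (q (swap_at k i)) = transport id (q k) \<otimes> inv (e k) \<otimes> e (swap_at k i)"
        using x e_closed[OF k] e_closed[OF k']
        by (simp add: q_swap[OF k i] step[OF q_closed[OF k] i'] perm_q[OF k] weight m_assoc)
      moreover have "transport id (q k) \<otimes> inv (e k) \<otimes> e (swap_at k i) = e (swap_at k i)
          \<longleftrightarrow> transport id (q k) \<otimes> inv (e k) = \<one>"
        using x e_closed[OF k] e_closed[OF k'] by simp
      moreover have "\<dots> \<longleftrightarrow> transport id (q k) = e k"
        using x e_closed[OF k] by (metis inv_solve_right' l_one one_closed)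
      ultimately show "transport id (q k) = e k \<longleftrightarrow> transport id (q (swap_at k i)) = e (swap_at k i)"
        by simp
    qed
    then show ?thesis using g unfolding Q_def by metis
  qed
  have "P (halves g) \<and> Q (pairs g)"
  proof (rule tree[unfolded connects_def, rule_format])
    show "P (halves id)"
      using P[OF permutes_id] by (simp add: t_id transport_one permutes_id)
    fix h assume h: "h permutes {1..6}" "edge_at h \<in> T"
    then have "t h = q h" "e h = \<one>" using agree e_tree by (simp_all add: t_def q_def)
    then show "P (halves h) \<longleftrightarrow> Q (pairs h)" using P[OF h(1)] Q[OF h(1)] by simp
  qed (rule assms)
  then show ?thesis using P[OF assms] Q[OF assms] by simp
qed

text \<open>The image under \<open>\<psi>\<close> of a label is a loop between lifts of known weight, so its
  transport can be read off: it is the label of the edge, or the weight of the swap at which a hexagon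
  is opened. Every coset contains an arrangement at which such a swap starts.\<close>

lemma transport_psi:
  assumes "y \<in> carrier F"
  shows "transport id (\<psi> y) = y"
proof (rule generated[OF _ _ assms])
  have mult: "transport id (\<psi> x \<cdot> U) = transport id (\<psi> x) \<otimes> transport id U"
    if "x \<in> carrier F" "U \<in> carrier (planar_braid_group 6)" for x U
    using transport_mult[OF psi.hom_closed[OF that(1)] that(2) permutes_id] perm_psi[OF that(1)] by simp
  show "(\<lambda>y. transport id (\<psi> y)) \<in> hom F F"
    by (rule homI) (simp_all add: transport_closed permutes_id psi.hom_closed psi.hom_mult mult)
  have closing: "transport id (\<psi> x) = weight h i"
    if "x \<in> carrier F" "h permutes {1..6}" "i \<in> {1..<6}" "t h \<cdot> \<sigma> i = \<psi> x \<cdot> t (swap_at h i)" for x h i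
  proof -
    have h': "swap_at h i permutes {1..6}" using that by (intro swap_at_permutes)
    have "transport id (\<psi> x) = transport id (\<psi> x \<cdot> t (swap_at h i))"
      using mult[OF that(1) t_closed[OF h']] transport_t_q[OF h']
        transport_closed[OF psi.hom_closed[OF that(1)] permutes_id] by simp
    also have "\<dots> = transport id (t h) \<otimes> weight h i"
      unfolding that(4)[symmetric]
      using transport_mult_generator[OF t_closed[OF that(2)] that(3) permutes_id] perm_t[OF that(2)] by simp
    finally show ?thesis
      using transport_t_q[OF that(2)] c_closed[OF that(2,3)] by simp
  qed
  fix g :: "nat \<Rightarrow> nat" assume g: "g permutes {1..6}"
  have ab: "a (halves g) \<in> carrier F" "b (halves g) \<in> carrier F"
    using ab_closed[of "halves g"] g by simp_all
  have "transport id (\<psi> (e g)) = transport id (\<psi> (e g) \<cdot> t g)"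
    using mult[OF e_closed[OF g] t_closed[OF g]] transport_t_q[OF g]
      transport_closed[OF psi.hom_closed[OF e_closed[OF g]] permutes_id] by simp
  also have "\<dots> = e g"
    using transport_t_q[OF g] by (simp add: psi_e_t[OF g])
  finally have e: "transport id (\<psi> (e g)) = e g" .
  obtain h where h: "h permutes {1..6}" "halves h = halves g" "h 2 < h 3" "h 3 < h 1"
    using closing_arrangement_exists(1)[OF g] by blast
  have "transport id (\<psi> (a (halves g))) = weight h 2"
    using t_closing(1)[OF h(1,3,4)] h(2) by (intro closing[OF ab(1) h(1)]) simp_all
  then have a: "transport id (\<psi> (a (halves g))) = a (halves g)"
    using h by (simp add: weight_def hexagon_weight_def)
  obtain k where k: "k permutes {1..6}" "halves k = halves g" "k 6 < k 4" "k 4 < k 5"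
    using closing_arrangement_exists(2)[OF g] by blast
  have "transport id (\<psi> (b (halves g))) = weight k 4"
    using t_closing(2)[OF k(1,3,4)] k(2) by (intro closing[OF ab(2) k(1)]) simp_all
  then have b: "transport id (\<psi> (b (halves g))) = b (halves g)"
    using k by (simp add: weight_def hexagon_weight_def)
  show "transport id (\<psi> (e g)) = e g \<and> transport id (\<psi> (a (halves g))) = a (halves g)
      \<and> transport id (\<psi> (b (halves g))) = b (halves g)"
    using e a b by blast
qed

theorem pure_braid_group_iso: "planar_pure_braid_group 6 \<cong> F"
proof -
  have carrier: "U \<in> carrier (planar_pure_braid_group 6) \<longleftrightarrow> U \<in> carrier (planar_braid_group 6) \<and> \<pi> U = id"
    for U by (simp add: planar_pure_braid_group_def kernel_def sym_group_one)
  have "transport id \<in> hom (planar_pure_braid_group 6) F"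
  proof (rule homI)
    fix U V assume "U \<in> carrier (planar_pure_braid_group 6)" "V \<in> carrier (planar_pure_braid_group 6)"
    then show "transport id (U \<otimes>\<^bsub>planar_pure_braid_group 6\<^esub> V) = transport id U \<otimes> transport id V"
      using transport_mult[OF _ _ permutes_id, of U V] carrier
      by (simp add: planar_pure_braid_group_def)
  qed (simp add: carrier transport_closed permutes_id)
  moreover have "bij_betw (transport id) (carrier (planar_pure_braid_group 6)) (carrier F)"
  proof (rule bij_betw_byWitness[where f' = \<psi>])
    show "\<forall>U\<in>carrier (planar_pure_braid_group 6). \<psi> (transport id U) = U"
    proof
      fix U assume "U \<in> carrier (planar_pure_braid_group 6)"
      then have U: "U \<in> carrier (planar_braid_group 6)" "\<pi> U = id" using carrier by auto
      show "\<psi> (transport id U) = U"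
        using psi_transport[OF U(1) permutes_id] U transport_closed[OF U(1) permutes_id]
        by (simp add: t_id psi.hom_closed)
    qed
    show "\<forall>y\<in>carrier F. transport id (\<psi> y) = y" using transport_psi by blast
    show "transport id ` carrier (planar_pure_braid_group 6) \<subseteq> carrier F"
      using carrier transport_closed permutes_id by auto
    show "\<psi> ` carrier F \<subseteq> carrier (planar_pure_braid_group 6)"
      using carrier perm_psi psi.hom_closed by auto
  qed
  ultimately show ?thesis
    unfolding is_iso_def iso_def by blast
qed

end

section \<open>Free products of copies of the integers and of their square\<close>

abbreviation mixed_factor :: "nat + nat \<Rightarrow> (nat \<Rightarrow>\<^sub>0 int) monoid"
  where "mixed_factor \<equiv> case_sum (\<lambda>_. free_Abelian_group {0}) (\<lambda>_. free_Abelian_group {0, 1})"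

abbreviation mixed_free_product :: "nat \<Rightarrow> nat \<Rightarrow> ((nat + nat) \<times> (nat \<Rightarrow>\<^sub>0 int)) list set monoid"
  where "mixed_free_product m n \<equiv> free_product ({..<m} <+> {..<n}) mixed_factor"

abbreviation mixed_letter :: "nat \<Rightarrow> nat \<Rightarrow> nat + nat \<Rightarrow> (nat \<Rightarrow>\<^sub>0 int) \<Rightarrow> ((nat + nat) \<times> (nat \<Rightarrow>\<^sub>0 int)) list set"
  where "mixed_letter m n \<equiv> free_product_letter ({..<m} <+> {..<n}) mixed_factor"

lemma group_mixed_factor: "group (mixed_factor i)"
  by (cases i) simp_all

lemma group_mixed_free_product: "group (mixed_free_product m n)"
  by (rule group_free_product) (rule group_mixed_factor)

lemma mixed_letter_hom:
  "i \<in> {..<m} <+> {..<n} \<Longrightarrow> mixed_letter m n i \<in> hom (mixed_factor i) (mixed_free_product m n)"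
  by (rule free_product_letter_hom[where G = mixed_factor, OF _ group_mixed_factor])

lemma mixed_free_product_universal:
  fixes x y z :: "nat \<Rightarrow> 'h"
  assumes "group H"
    and x: "\<And>k. k < m \<Longrightarrow> x k \<in> carrier H"
    and yz: "\<And>k. k < n \<Longrightarrow> y k \<in> carrier H \<and> z k \<in> carrier H \<and> y k \<otimes>\<^bsub>H\<^esub> z k = z k \<otimes>\<^bsub>H\<^esub> y k"
  obtains f where "f \<in> hom (mixed_free_product m n) H"
    "\<And>k. k < m \<Longrightarrow> f (mixed_letter m n (Inl k) (frag_of 0)) = x k"
    "\<And>k. k < n \<Longrightarrow> f (mixed_letter m n (Inr k) (frag_of 0)) = y k"
    "\<And>k. k < n \<Longrightarrow> f (mixed_letter m n (Inr k) (frag_of 1)) = z k"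
proof -
  interpret H: group H by fact
  define u :: "nat + nat \<Rightarrow> 'h" where "u = case_sum x y"
  define v :: "nat + nat \<Rightarrow> 'h" where "v = case_sum (\<lambda>_. \<one>\<^bsub>H\<^esub>) z"
  define \<phi> :: "nat + nat \<Rightarrow> (nat \<Rightarrow>\<^sub>0 int) \<Rightarrow> 'h"
    where "\<phi> i = (\<lambda>c. u i [^]\<^bsub>H\<^esub> Poly_Mapping.lookup c 0 \<otimes>\<^bsub>H\<^esub> v i [^]\<^bsub>H\<^esub> Poly_Mapping.lookup c 1)" for i
  have uv: "u i \<in> carrier H" "v i \<in> carrier H" "u i \<otimes>\<^bsub>H\<^esub> v i = v i \<otimes>\<^bsub>H\<^esub> u i"
    if "i \<in> {..<m} <+> {..<n}" for i
    using that x yz by (auto simp: u_def v_def)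
  have \<phi>: "\<phi> i \<in> hom (mixed_factor i) H" if "i \<in> {..<m} <+> {..<n}" for i
    unfolding \<phi>_def
    using free_Abelian_group_pair_hom[OF H.is_group uv[OF that], where i = 0 and j = 1]
    by (cases i) simp_all
  obtain f where f: "f \<in> hom (mixed_free_product m n) H"
    "\<And>i c. i \<in> {..<m} <+> {..<n} \<Longrightarrow> c \<in> carrier (mixed_factor i) \<Longrightarrow> f (mixed_letter m n i c) = \<phi> i c"
    by (rule free_product_universal[where G = mixed_factor and f = \<phi> and I = "{..<m} <+> {..<n}",
      OF H.is_group group_mixed_factor \<phi>]) (assumption, rule that)
  have "f (mixed_letter m n (Inl k) (frag_of 0)) = x k" if "k < m" for k
    using f(2)[of "Inl k" "frag_of 0"] that x
    by (simp add: \<phi>_def u_def v_def lookup_single InlI)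
  moreover have "f (mixed_letter m n (Inr k) (frag_of 0)) = y k"
    "f (mixed_letter m n (Inr k) (frag_of 1)) = z k" if "k < n" for k
    using f(2)[of "Inr k" "frag_of 0"] f(2)[of "Inr k" "frag_of 1"] that yz
    by (simp_all add: \<phi>_def u_def v_def lookup_single InrI del: single_one)
  ultimately show thesis using f(1) that by blast
qed

lemma mixed_free_product_hom_eqI:
  assumes "group H" and f: "f \<in> hom (mixed_free_product m n) H" and g: "g \<in> hom (mixed_free_product m n) H"
    and free: "\<And>k. k < m \<Longrightarrow> f (mixed_letter m n (Inl k) (frag_of 0)) = g (mixed_letter m n (Inl k) (frag_of 0))"
    and abelian: "\<And>k s. k < n \<Longrightarrow> s \<in> {0, 1} \<Longrightarrow>
      f (mixed_letter m n (Inr k) (frag_of s)) = g (mixed_letter m n (Inr k) (frag_of s))"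
    and y: "y \<in> carrier (mixed_free_product m n)"
  shows "f y = g y"
proof (rule free_product_hom_eqI[OF assms(1) group_mixed_factor f g _ y])
  fix i c assume i: "i \<in> {..<m} <+> {..<n}" and c: "c \<in> carrier (mixed_factor i)"
  have letter: "mixed_letter m n i \<in> hom (mixed_factor i) (mixed_free_product m n)"
    using i by (rule mixed_letter_hom)
  have comp: "(\<lambda>c. f (mixed_letter m n i c)) \<in> hom (mixed_factor i) H"
    "(\<lambda>c. g (mixed_letter m n i c)) \<in> hom (mixed_factor i) H"
    using hom_compose[OF letter f] hom_compose[OF letter g] by (simp_all add: o_def)
  show "f (mixed_letter m n i c) = g (mixed_letter m n i c)"
  proof (cases i)
    case (Inl k)
    then have "k < m" using i by auto
    show ?thesis
      by (rule free_Abelian_group_hom_eqI[OF assms(1), where S = "{0}"])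
        (use Inl comp c free \<open>k < m\<close> in simp_all)
  next
    case (Inr k)
    then have "k < n" using i by auto
    show ?thesis
      by (rule free_Abelian_group_hom_eqI[OF assms(1), where S = "{0, 1}"])
        (use Inr comp c abelian \<open>k < n\<close> in auto)
  qed
qed

text \<open>The free factors of rank one are indexed by the edges outside the spanning tree and those of
  rank two by the cosets of order 36, both through arbitrary bijections. A generator is sent to the
  quotient of the two lifts of an arrangement on its edge, or to a turn around a hexagon
  conjugated by the lift of its coset.\<close>

theorem theorem2:
  shows "planar_pure_braid_group 6 \<cong>
    free_product ({..<71::nat} <+> {..<20::nat})
      (case_sum (\<lambda>_. free_Abelian_group {0::nat}) (\<lambda>_. free_Abelian_group {0, 1}))"
proof -
  let ?W = "planar_braid_group 6" and ?F = "mixed_free_product 71 20"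
  let ?letter = "mixed_letter 71 20"
  interpret F: group ?F by (rule group_mixed_free_product)
  obtain T r \<rho> where T: "T \<subseteq> edge_at ` S6" "card T = 109"
    and tree: "connects T"
    and r_base: "r (halves id) = \<one>\<^bsub>?W\<^esub>"
    and r: "\<And>g. g permutes {1..6} \<Longrightarrow> r (halves g) \<in> carrier ?W \<and> \<pi> (r (halves g) \<cdot> halves_section g) = g"
    and \<rho>: "\<And>g. g permutes {1..6} \<Longrightarrow> \<rho> (pairs g) \<in> carrier ?W \<and> \<pi> (\<rho> (pairs g) \<cdot> pairs_section g) = g"
    and agree: "\<And>g. g permutes {1..6} \<Longrightarrow> edge_at g \<in> T \<Longrightarrow>
      r (halves g) \<cdot> halves_section g = \<rho> (pairs g) \<cdot> pairs_section g"
    by (rule compatible_lifts) (rule that)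
  have fin: "finite S6" by (simp add: finite_permutations)
  have "card (edge_at ` S6 - T) = 71"
    using T fin card_edges finite_subset[OF T(1)] by (simp add: card_Diff_subset)
  then obtain j where j: "bij_betw j (edge_at ` S6 - T) {..<71::nat}"
    using finite_same_card_bij[of "edge_at ` S6 - T" "{..<71::nat}"] fin by auto
  obtain k where k: "bij_betw k (halves ` S6) {..<20::nat}"
    using finite_same_card_bij[of "halves ` S6" "{..<20::nat}"] fin card_halves by auto
  have j_lt: "j \<epsilon> < 71" if "\<epsilon> \<in> edge_at ` S6 - T" for \<epsilon>
    using bij_betwE[OF j] that by blast
  have k_lt: "k v < 20" if "v \<in> halves ` S6" for v
    using bij_betwE[OF k] that by blast
  have j_surj: "\<exists>g. g permutes {1..6} \<and> edge_at g \<notin> T \<and> j (edge_at g) = i" if "i < 71" for i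
  proof -
    have "i \<in> j ` (edge_at ` S6 - T)" using that bij_betw_imp_surj_on[OF j] by simp
    then show ?thesis by blast
  qed
  have k_surj: "\<exists>g. g permutes {1..6} \<and> k (halves g) = i" if "i < 20" for i
  proof -
    have "i \<in> k ` halves ` S6" using that bij_betw_imp_surj_on[OF k] by simp
    then show ?thesis by blast
  qed
  have letter_closed: "?letter i c \<in> carrier ?F"
    if "i \<in> {..<71} <+> {..<20}" "c \<in> carrier (mixed_factor i)" for i c
    using hom_in_carrier[OF mixed_letter_hom[OF that(1)] that(2)] .

  define e where "e g = (if edge_at g \<in> T then \<one>\<^bsub>?F\<^esub> else ?letter (Inl (j (edge_at g))) (frag_of 0))"
    for g
  define a where "a v = ?letter (Inr (k v)) (frag_of 0)" for v
  define b where "b v = ?letter (Inr (k v)) (frag_of 1)" for v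
  define t where "t g = r (halves g) \<cdot> halves_section g" for g
  define q where "q g = \<rho> (pairs g) \<cdot> pairs_section g" for g
  have t: "t g \<in> carrier ?W" "\<pi> (t g) = g" if "g permutes {1..6}" for g
    using r[OF that] by (simp_all add: t_def halves_section_closed)
  have q: "q g \<in> carrier ?W" "\<pi> (q g) = g" if "g permutes {1..6}" for g
    using \<rho>[OF that] by (simp_all add: q_def pairs_section_closed)

  define at_edge where "at_edge i = (SOME g. g permutes {1..6} \<and> edge_at g \<notin> T \<and> j (edge_at g) = i)" for i
  define at_half where "at_half i = (SOME g. g permutes {1..6} \<and> k (halves g) = i)" for i
  have at_edge: "at_edge i permutes {1..6}" "edge_at (at_edge i) \<notin> T" "j (edge_at (at_edge i)) = i"
    if "i < 71" for i
    using someI_ex[OF j_surj[OF that]] unfolding at_edge_def by blast+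
  have at_half: "at_half i permutes {1..6}" "k (halves (at_half i)) = i" if "i < 20" for i
    using someI_ex[OF k_surj[OF that]] unfolding at_half_def by blast+
  \<comment> \<open>The loops that will be the images of the generators: around an edge outside the tree, and
    around a hexagon.\<close>
  define X where "X i = q (at_edge i) \<cdot> inv\<^bsub>?W\<^esub> t (at_edge i)" for i
  define Y where "Y p' q' i = r (halves (at_half i)) \<cdot> W.hexagon_loop (\<sigma> p') (\<sigma> q')
    \<cdot> inv\<^bsub>?W\<^esub> r (halves (at_half i))" for p' q' i
  have X: "X i \<in> carrier ?W" if "i < 71" for i
    using t q at_edge[OF that] by (simp add: X_def)
  have loop: "W.hexagon_loop (\<sigma> 1) (\<sigma> 2) \<in> carrier ?W" "W.hexagon_loop (\<sigma> 5) (\<sigma> 4) \<in> carrier ?W"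
    by (simp_all add: W.hexagon_loop_closed sigma_closed)
  have Y: "Y 1 2 i \<in> carrier ?W" "Y 5 4 i \<in> carrier ?W"
    "Y 1 2 i \<cdot> r (halves (at_half i)) = r (halves (at_half i)) \<cdot> W.hexagon_loop (\<sigma> 1) (\<sigma> 2)"
    "Y 5 4 i \<cdot> r (halves (at_half i)) = r (halves (at_half i)) \<cdot> W.hexagon_loop (\<sigma> 5) (\<sigma> 4)"
    if "i < 20" for i
    using r[OF at_half(1)[OF that]] loop by (simp_all add: Y_def W.m_assoc)
  have Y_commute: "Y 1 2 i \<cdot> Y 5 4 i = Y 5 4 i \<cdot> Y 1 2 i" if "i < 20" for i
  proof -
    let ?r = "r (halves (at_half i))"
    have rc: "?r \<in> carrier ?W" using r[OF at_half(1)[OF that]] by simp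
    have conj: "(?r \<cdot> u \<cdot> inv\<^bsub>?W\<^esub> ?r) \<cdot> (?r \<cdot> v \<cdot> inv\<^bsub>?W\<^esub> ?r) = ?r \<cdot> (u \<cdot> v) \<cdot> inv\<^bsub>?W\<^esub> ?r"
      if uv: "u \<in> carrier ?W" "v \<in> carrier ?W" for u v
    proof -
      have "inv\<^bsub>?W\<^esub> ?r \<cdot> (?r \<cdot> w) = w" if "w \<in> carrier ?W" for w
        using rc that by (simp flip: W.m_assoc)
      then show ?thesis using rc uv by (simp add: W.m_assoc)
    qed
    show ?thesis
      unfolding Y_def conj[OF loop] conj[OF loop(2,1)] hexagon_loops_commute ..
  qed
  obtain \<psi> where \<psi>: "\<psi> \<in> hom ?F ?W"
    and \<psi>_free: "\<And>i. i < 71 \<Longrightarrow> \<psi> (?letter (Inl i) (frag_of 0)) = X i"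
    and \<psi>_a: "\<And>i. i < 20 \<Longrightarrow> \<psi> (?letter (Inr i) (frag_of 0)) = Y 1 2 i"
    and \<psi>_b: "\<And>i. i < 20 \<Longrightarrow> \<psi> (?letter (Inr i) (frag_of 1)) = Y 5 4 i"
    using mixed_free_product_universal[OF W.is_group, where x = X and y = "Y 1 2" and z = "Y 5 4"
      and m = 71 and n = 20] X Y(1,2) Y_commute by metis

  \<comment> \<open>Loops between lifts of the same arrangement are pure.\<close>
  have perm_trivial: "\<pi> x = id"
    if "x \<in> carrier ?W" "y \<in> carrier ?W" "z \<in> carrier ?W" "x \<cdot> y = z" "\<pi> z = \<pi> y" for x y z
  proof -
    have "\<pi> x \<circ> \<pi> y = \<pi> y" using planar_braid_perm_mult[OF that(1,2)] that(4,5) by simp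
    then have "\<pi> x \<circ> (\<pi> y \<circ> inv' (\<pi> y)) = \<pi> y \<circ> inv' (\<pi> y)" by (simp add: o_assoc)
    then show ?thesis using permutes_inv_o(1)[OF planar_braid_perm_permutes[OF that(2)]] by simp
  qed
  have X_t: "X i \<cdot> t (at_edge i) = q (at_edge i)" if "i < 71" for i
    using t(1)[OF at_edge(1)[OF that]] q(1)[OF at_edge(1)[OF that]] by (simp add: X_def W.m_assoc)
  have perm_X: "\<pi> (X i) = id" if "i < 71" for i
    using t[OF at_edge(1)[OF that]] q[OF at_edge(1)[OF that]]
    by (intro perm_trivial[OF X[OF that] _ _ X_t[OF that]]) simp_all
  have perm_Y: "\<pi> (Y 1 2 i) = id" "\<pi> (Y 5 4 i) = id" if "i < 20" for i
  proof -
    have rc: "r (halves (at_half i)) \<in> carrier ?W" using r[OF at_half(1)[OF that]] by simp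
    show "\<pi> (Y 1 2 i) = id"
      by (rule perm_trivial[OF Y(1)[OF that] rc _ Y(3)[OF that]])
        (use rc loop in \<open>simp_all add: planar_braid_perm_mult perm_hexagon_loop\<close>)
    show "\<pi> (Y 5 4 i) = id"
      by (rule perm_trivial[OF Y(2)[OF that] rc _ Y(4)[OF that]])
        (use rc loop in \<open>simp_all add: planar_braid_perm_mult perm_hexagon_loop\<close>)
  qed

  interpret weights: graph_of_groups_weights ?F e a b
  proof unfold_locales
    show "e g \<in> carrier ?F" if "g permutes {1..6}" for g
      using that j_lt[of "edge_at g"] letter_closed[of "Inl (j (edge_at g))" "frag_of 0"]
      by (auto simp: e_def)
    show "e (swap_at g i) = e g" if "i \<in> {1, 5}" for g i
      using edge_at_swap_at[OF that, of g] by (simp add: e_def)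
    fix v assume "v \<in> halves ` S6"
    then have i: "Inr (k v) \<in> {..<71} <+> {..<20}" using k_lt[of v] by (simp add: InrI)
    show "a v \<in> carrier ?F \<and> b v \<in> carrier ?F"
      using letter_closed[OF i] by (simp add: a_def b_def)
    have "?letter (Inr (k v)) (frag_of 0 + frag_of 1)
        = a v \<otimes>\<^bsub>?F\<^esub> b v" "?letter (Inr (k v)) (frag_of 1 + frag_of 0) = b v \<otimes>\<^bsub>?F\<^esub> a v"
      using hom_mult[OF mixed_letter_hom[OF i], of "frag_of 0" "frag_of 1"]
        hom_mult[OF mixed_letter_hom[OF i], of "frag_of 1" "frag_of 0"]
      by (simp_all add: a_def b_def)
    then show "a v \<otimes>\<^bsub>?F\<^esub> b v = b v \<otimes>\<^bsub>?F\<^esub> a v" by (simp add: add.commute)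
  qed

  interpret pure_braid_splitting ?F e a b T r \<rho> \<psi>
  proof unfold_locales
    show "e g = \<one>\<^bsub>?F\<^esub>" if "edge_at g \<in> T" for g using that by (simp add: e_def)
    show "\<psi> (e g) \<cdot> (r (halves g) \<cdot> halves_section g) = \<rho> (pairs g) \<cdot> pairs_section g"
      if g: "g permutes {1..6}" for g
    proof (cases "edge_at g \<in> T")
      case True
      then show ?thesis
        using agree[OF g] hom_one[OF \<psi> F.is_group W.is_group] q(1)[OF g] by (simp add: e_def q_def)
    next
      case False
      then have edge: "edge_at g \<in> edge_at ` S6 - T" using g by blast
      define i where "i = j (edge_at g)"
      have i: "i < 71" unfolding i_def using edge by (rule j_lt)
      have "edge_at (at_edge i) \<in> edge_at ` S6 - T" using at_edge[OF i] by blast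
      then have same: "edge_at (at_edge i) = edge_at g"
        using at_edge(3)[OF i] edge inj_onD[OF bij_betw_imp_inj_on[OF j]] unfolding i_def by blast
      then have cells: "halves (at_edge i) = halves g" "pairs (at_edge i) = pairs g"
        by (metis halves_of_edge_at) (metis same pairs_of_edge_at)
      have "(X i \<cdot> r (halves g)) \<cdot> halves_section (at_edge i) = \<rho> (pairs g) \<cdot> pairs_section (at_edge i)"
        using X_t[OF i] X[OF i] r[OF g] by (simp add: t_def q_def cells W.m_assoc halves_section_closed)
      then have "(X i \<cdot> r (halves g)) \<cdot> halves_section g = \<rho> (pairs g) \<cdot> pairs_section g"
        using X[OF i] r[OF g] \<rho>[OF g] sections_agree_on_edge[OF _ _ at_edge(1)[OF i] g same] by simp
      then show ?thesis
        using False \<psi>_free[OF i] X[OF i] r[OF g]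
        by (simp add: e_def i_def[symmetric] W.m_assoc halves_section_closed)
    qed
    fix g :: "nat \<Rightarrow> nat" assume g: "g permutes {1..6}"
    define i where "i = k (halves g)"
    have i: "i < 20" unfolding i_def using g k_lt by blast
    have same: "halves (at_half i) = halves g"
      using at_half[OF i] g inj_onD[OF bij_betw_imp_inj_on[OF k]] unfolding i_def by blast
    show "\<psi> (a (halves g)) \<cdot> r (halves g) = r (halves g) \<cdot> W.hexagon_loop (\<sigma> 1) (\<sigma> 2)"
      using Y(3)[OF i] \<psi>_a[OF i] by (simp add: a_def i_def[symmetric] same)
    show "\<psi> (b (halves g)) \<cdot> r (halves g) = r (halves g) \<cdot> W.hexagon_loop (\<sigma> 5) (\<sigma> 4)"
      using Y(4)[OF i] \<psi>_b[OF i] by (simp add: b_def i_def[symmetric] same)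
  next
    fix y assume y: "y \<in> carrier ?F"
    have "(\<lambda>y. \<pi> (\<psi> y)) \<in> hom ?F (sym_group 6)"
      using hom_compose[OF \<psi> planar_braid_perm_hom] by (simp add: o_def)
    moreover have "(\<lambda>_. id) \<in> hom ?F (sym_group 6)"
      by (rule homI) (simp_all add: sym_group_carrier sym_group_mult permutes_id)
    ultimately show "\<pi> (\<psi> y) = id"
      by (rule mixed_free_product_hom_eqI[OF sym_group_is_group _ _ _ _ y])
        (auto simp: \<psi>_free \<psi>_a \<psi>_b perm_X perm_Y simp del: single_one)
  next
    fix f y
    assume f: "f \<in> hom ?F ?F" and y: "y \<in> carrier ?F"
      and fixed: "\<And>g. g permutes {1..6} \<Longrightarrow>
        f (e g) = e g \<and> f (a (halves g)) = a (halves g) \<and> f (b (halves g)) = b (halves g)"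
    have id_hom: "(\<lambda>y. y) \<in> hom ?F ?F" by (simp add: hom_def)
    show "f y = y"
    proof (rule mixed_free_product_hom_eqI[OF F.is_group f id_hom _ _ y])
      show "f (?letter (Inl i) (frag_of 0)) = ?letter (Inl i) (frag_of 0)" if "i < 71" for i
        using fixed[OF at_edge(1)[OF that]] at_edge(2,3)[OF that] by (simp add: e_def)
      show "f (?letter (Inr i) (frag_of s)) = ?letter (Inr i) (frag_of s)"
        if "i < 20" "s \<in> {0, 1}" for i s
        using fixed[OF at_half(1)[OF that(1)]] at_half(2)[OF that(1)] that(2) by (auto simp: a_def b_def)
    qed
  qed (use \<psi> tree r_base r \<rho> agree in simp_all)
  show ?thesis by (rule pure_braid_group_iso)
qed

end
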